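(* Let $R$ be the curvature operator on $\Lambda^2=\Lambda^2(\mathbb{R}^4)$ given by a Riemann tensor in dimension $n=4$, let $I$ be the identity operator on $\Lambda^2$, and let $K$ be the operator on $\Lambda^2$ given by the $4$-volume form with two indices raised. Put $p(x,y)=\det(R-xI-yK)$ and $q(x)=\mathrm{disc}_y(p(x,y))$. Then: (a) The set of real roots of $q$ includes the set of critical values of the sectional curvature of $R$. If $\mathrm{disc}_x(q(x))\neq 0$, the two sets coincide. (b) If all real roots of $q$ are positive (respectively nonnegative), then $R$ is sectionally positive (respectively sectionally nonnegative). (c) If $\mathrm{disc}_x(q(x))\neq 0$, the converse of (b) also holds: $R$ is sectionally positive (respectively nonnegative) if and only if all real roots of $q$ are positive (respectively nonnegative).
   Context: Work at a single point with fixed metric, i.e. on $\mathbb{R}^4$ with its standard inner product and orientation. $\Lambda^2$ is the $6$-dimensional space of $2$-forms, with the inner product for which $e_a\wedge e_b$ ($a<b$) is orthonormal. A Riemann tensor $R_{abcd}$ (with the usual symmetries of a curvature tensor, $R_{abcd}=-R_{bacd}=R_{cdab}$ and the first Bianchi identity) is regarded as a self-adjoint operator $R$ on $\Lambda^2$; write $vRv=\langle v,Rv\rangle$. The operator $K$ is the self-adjoint operator $(Kv)_{ab}=\tfrac12\sum_{c,d}K_{abcd}v_{cd}$, with $K_{abcd}$ the volume form; equivalently $K$ is the Hodge star on $\Lambda^2(\mathbb{R}^4)$, with eigenvalues $1$ and $-1$, each of multiplicity $3$. Let $S_2$ be the set of decomposable $2$-forms of norm $1$ (those $v\in\Lambda^2$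 with $\langle v,v\rangle=1$ and $v=A\wedge B$ for some $1$-forms $A,B$); it is the Grassmannian of oriented $2$-planes in $\mathbb{R}^4$. The sectional curvature of $R$ is the function $f:S_2\to\mathbb{R}$, $f(v)=vRv$; its critical values are the values $f(v)$ at critical points $v\in S_2$ of $f$. $R$ is sectionally positive (nonnegative) if $f(v)>0$ ($f(v)\ge 0$) for all $v\in S_2$. $\mathrm{disc}_y$ denotes the discriminant with respect to the variable $y$ (for a polynomial $g$ of degree $d$, the determinant of the Sylvester matrix of $g$ and $g'$); it vanishes if and only if the polynomial has a multiple complex root. The polynomial $p(x,y)$ has degree $6$ in $y$ for every $x$. The discriminant of the zero polynomial is taken to be $0$, so $\mathrm{disc}_x(q)\ne0$ means that $q$ is not identically zero and has no multiple complex root. *)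

theory Defs
  imports "Subresultants.Resultant_Prelim" "HOL-Analysis.Analysis"
begin

no_notation vec_index (infixl "$" 100) and scalar_prod (infix "\<bullet>" 70)

section \<open>2-forms on Euclidean 4-space\<close>

text \<open>The indices of $\mathbb{R}^4$ form the type \<^typ>\<open>4\<close>, whose elements are \<open>1, 2, 3, 4\<close>. Here
  \<open>4 = 0\<close>, so the order of this type is \<open>4 < 1 < 2 < 3\<close>. It is only used to choose one pair
  from each two-element set of indices, that is, a sign for each basis vector of \<open>\<Lambda>\<^sup>2\<close>.\<close>

typedef idx2 = "{p :: 4 \<times> 4. fst p < snd p}"
  by (rule exI[of _ "(1, 2)"]) (simp add: less_bit0_def Abs_bit0'_def bit0.Rep_1 bit0.Rep_numeral)

instance idx2 :: finite
proof
  show "finite (UNIV :: idx2 set)"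
    unfolding type_definition.Abs_image[OF type_definition_idx2, symmetric] by simp
qed

text \<open>A 2-form is given by its components \<open>v\<^sub>a\<^sub>b\<close>, \<open>a < b\<close>, so that the standard inner product
  of \<^typ>\<open>real^idx2\<close> makes the forms \<open>e\<^sub>a \<and> e\<^sub>b\<close>, \<open>a < b\<close>, orthonormal.\<close>

type_synonym form2 = "real^idx2"

definition comp :: "form2 \<Rightarrow> 4 \<Rightarrow> 4 \<Rightarrow> real" where
  "comp v a b =
     (if a < b then v $ Abs_idx2 (a, b) else if b < a then - v $ Abs_idx2 (b, a) else 0)"

definition wedge :: "real^4 \<Rightarrow> real^4 \<Rightarrow> form2" where
  "wedge A B = (\<chi> i. case Rep_idx2 i of (a, b) \<Rightarrow> A $ a * B $ b - A $ b * B $ a)"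

definition form_op :: "(4 \<Rightarrow> 4 \<Rightarrow> 4 \<Rightarrow> 4 \<Rightarrow> real) \<Rightarrow> form2 \<Rightarrow> form2" where
  "form_op T v = (\<chi> i. case Rep_idx2 i of (a, b) \<Rightarrow>
     (1/2) * (\<Sum>c\<in>UNIV. \<Sum>d\<in>UNIV. T a b c d * comp v c d))"

definition riemann_tensor :: "(4 \<Rightarrow> 4 \<Rightarrow> 4 \<Rightarrow> 4 \<Rightarrow> real) \<Rightarrow> bool" where
  "riemann_tensor R \<longleftrightarrow> (\<forall>a b c d.
     R a b c d = - R b a c d \<and> R a b c d = R c d a b \<and> R a b c d + R a c d b + R a d b c = 0)"

text \<open>The volume form of the standard metric and orientation, \<open>K\<^sub>1\<^sub>2\<^sub>3\<^sub>4 = 1\<close>.\<close>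

definition vol_form :: "4 \<Rightarrow> 4 \<Rightarrow> 4 \<Rightarrow> 4 \<Rightarrow> real" where
  "vol_form a b c d = det (vector [axis a 1, axis b 1, axis c 1, axis d 1] :: real^4^4)"


section \<open>Sectional curvature\<close>

definition S2 :: "form2 set" where
  "S2 = {v. v \<bullet> v = 1 \<and> (\<exists>A B. v = wedge A B)}"

definition sec_curv :: "(4 \<Rightarrow> 4 \<Rightarrow> 4 \<Rightarrow> 4 \<Rightarrow> real) \<Rightarrow> form2 \<Rightarrow> real" where
  "sec_curv R v = v \<bullet> form_op R v"

text \<open>Critical points of a function on a submanifold \<open>S\<close> of a normed space: the derivative
  vanishes along every curve in \<open>S\<close> through the point. The curves are only required to be
  differentiable at that point; their velocities are still exactly the tangent vectors of \<open>S\<close>.\<close>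

definition critical_point_on :: "'a::real_normed_vector set \<Rightarrow> ('a \<Rightarrow> real) \<Rightarrow> 'a \<Rightarrow> bool" where
  "critical_point_on S f v \<longleftrightarrow> v \<in> S \<and>
     (\<forall>\<gamma> \<gamma>'. range \<gamma> \<subseteq> S \<and> \<gamma> 0 = v \<and> (\<gamma> has_vector_derivative \<gamma>') (at 0)
        \<longrightarrow> ((\<lambda>t::real. f (\<gamma> t)) has_real_derivative 0) (at 0))"

definition critical_values_on :: "'a::real_normed_vector set \<Rightarrow> ('a \<Rightarrow> real) \<Rightarrow> real set" where
  "critical_values_on S f = f ` {v. critical_point_on S f v}"

definition sectionally_positive :: "(4 \<Rightarrow> 4 \<Rightarrow> 4 \<Rightarrow> 4 \<Rightarrow> real) \<Rightarrow> bool" where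
  "sectionally_positive R \<longleftrightarrow> (\<forall>v\<in>S2. sec_curv R v > 0)"

definition sectionally_nonnegative :: "(4 \<Rightarrow> 4 \<Rightarrow> 4 \<Rightarrow> 4 \<Rightarrow> real) \<Rightarrow> bool" where
  "sectionally_nonnegative R \<longleftrightarrow> (\<forall>v\<in>S2. sec_curv R v \<ge> 0)"


section \<open>The polynomials\<close>

text \<open>\<open>resultant g (pderiv g)\<close> is by definition the determinant of the Sylvester matrix. For
  \<open>g = 0\<close> that matrix is empty and its determinant is 1, hence the case distinction.\<close>

definition discr :: "'a::{comm_ring_1,semiring_no_zero_divisors} poly \<Rightarrow> 'a" where
  "discr g = (if g = 0 then 0 else resultant g (pderiv g))"

text \<open>\<open>p(x,y) = det(R - x I - y K)\<close> as a polynomial in \<open>y\<close> over $\mathbb{R}[x]$: here \<open>x\<close> is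
  \<open>[:[:0, 1:]:]\<close>, \<open>y\<close> is \<open>[:0, 1:]\<close>, and a real constant \<open>r\<close> is \<open>[:[:r:]:]\<close>.\<close>

definition p_poly :: "(4 \<Rightarrow> 4 \<Rightarrow> 4 \<Rightarrow> 4 \<Rightarrow> real) \<Rightarrow> real poly poly" where
  "p_poly R = det (\<chi> i j.
     [:[:matrix (form_op R) $ i $ j:]:]
     - [:[:0, 1:]:] * (mat 1 :: real poly poly^idx2^idx2) $ i $ j
     - [:0, 1:] * [:[:matrix (form_op vol_form) $ i $ j:]:])"

definition q_poly :: "(4 \<Rightarrow> 4 \<Rightarrow> 4 \<Rightarrow> 4 \<Rightarrow> real) \<Rightarrow> real poly" where
  "q_poly R = discr (p_poly R)"

lemma poly_p_poly:
  "poly (poly (p_poly R) [:y:]) x =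
     det (matrix (form_op R) - x *\<^sub>R mat 1 - y *\<^sub>R matrix (form_op vol_form))"
proof -
  have "poly (poly (\<Prod>i\<in>A. f i) [:y:]) x = (\<Prod>i\<in>A. poly (poly (f i) [:y:]) x)"
    for f :: "idx2 \<Rightarrow> real poly poly" and A
    by (simp add: poly_prod)
  moreover have "poly (poly (of_int k) [:y:]) x = of_int k" for k
    by (simp add: of_int_poly)
  ultimately show ?thesis
    by (auto simp: p_poly_def det_def poly_sum mat_def intro!: sum.cong prod.cong)
qed

end

theory Submission
  imports Defs "Subresultants.Subresultant_Gcd" "HOL-Computational_Algebra.Field_as_Ring"
    "HOL-Computational_Algebra.Fundamental_Theorem_Algebra"
begin

no_notation vec_index (infixl "$" 100) and scalar_prod (infix "\<bullet>" 70)

text \<open>Write \<open>K\<close> for the Hodge star \<open>form_op vol_form\<close>. By the Pluecker relation, \<open>S2\<close> is cut out of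
  the unit sphere of \<open>\<Lambda>\<^sup>2\<close> by the quadratic equation \<open>v \<bullet> K v = 0\<close>. The gradients \<open>v\<close> and \<open>K v\<close> of the
  two constraints are orthonormal on \<open>S2\<close>, so \<open>v\<close> is a critical point of the sectional curvature
  exactly if \<open>R v = x v + y K v\<close> for some multipliers \<open>x\<close>, \<open>y\<close>, and pairing with \<open>v\<close> shows that \<open>x\<close>
  is then the critical value (\<open>critical_point_iff\<close>, \<open>sec_curv_multiplier\<close>). Critical points are
  therefore kernel vectors of the symmetric pencil \<open>M = R - x I - y K\<close> that are null for \<open>K\<close>.

  These are compared with multiple roots of \<open>p(x, \<sqdot>)\<close> by means of the derivative \<open>L\<close> of the
  determinant at a singular matrix \<open>M\<close>. If \<open>M w = 0\<close> and \<open>u M = 0\<close> with \<open>u, w \<noteq> 0\<close>, then \<open>L N\<close> is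
  a fixed multiple \<open>c\<close> of \<open>u \<bullet> N w\<close> (\<open>det_derivative_singular\<close>). For the symmetric pencil with kernel vector
  \<open>v\<close> this says that \<open>\<partial>\<^sub>y p = - c (v \<bullet> K v)\<close> and \<open>\<partial>\<^sub>x p = - c (v \<bullet> v)\<close> at \<open>(x, y)\<close>. A null kernel
  vector thus makes \<open>y\<close> a multiple root of \<open>p(x, \<sqdot>)\<close>, whence \<open>q(x) = 0\<close>.

  Conversely let \<open>q(x) = 0\<close>, where \<open>q\<close> has only simple roots. The leading coefficient of \<open>p\<close> in \<open>y\<close>
  is a nonzero constant, so \<open>p(x, \<sqdot>)\<close> has a multiple complex root \<open>y\<close>. Two situations have to be
  excluded, because each of them would make \<open>x\<close> a multiple root of \<open>q\<close>: a root \<open>y\<close> that is not real,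
  which comes with the multiple root conjugate to it; and a real \<open>y\<close> at which \<open>\<partial>\<^sub>x p\<close> vanishes too, a
  singular point of the curve \<open>p = 0\<close>. Both follow from the same derivative formula, applied to the
  Sylvester matrix of \<open>p(x, \<sqdot>)\<close> and its derivative, whose determinant is \<open>q(x)\<close>: a root
  common to two polynomials gives a kernel vector of their Sylvester matrix
  (\<open>discr_derivative_eq_0_if_nonreal_double_root\<close>, \<open>discr_derivative_eq_0_if_singular_point\<close>). In
  the remaining case \<open>y\<close> is real and \<open>\<partial>\<^sub>x p \<noteq> 0\<close>; for any kernel vector \<open>v\<close> this gives \<open>c \<noteq> 0\<close>, so
  that \<open>\<partial>\<^sub>y p = 0\<close> forces \<open>v \<bullet> K v = 0\<close>, and normalising \<open>v\<close> yields a critical point.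

  The statements about signs follow because \<open>S2\<close> is compact and nonempty: the sectional curvature
  attains its minimum, and this is one of its critical values.\<close>


section \<open>The space of 2-forms and the Hodge star\<close>

lemma less_4 [simp]:
  "(4::4) < 1" "(4::4) < 2" "(4::4) < 3" "(1::4) < 2" "(1::4) < 3" "(2::4) < 3"
  "\<not> (1::4) < 4" "\<not> (2::4) < 4" "\<not> (3::4) < 4" "\<not> (2::4) < 1" "\<not> (3::4) < 1" "\<not> (3::4) < 2"
  by (simp_all add: less_bit0_def bit0.Rep_1 bit0.Rep_numeral)

lemma Rep_Abs_idx2: "a < b \<Longrightarrow> Rep_idx2 (Abs_idx2 (a, b)) = (a, b)"
  by (simp add: Abs_idx2_inverse)

lemma sum_idx2:
  fixes f :: "idx2 \<Rightarrow> 'a::comm_monoid_add"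
  shows "sum f UNIV = f (Abs_idx2 (4,1)) + f (Abs_idx2 (4,2)) + f (Abs_idx2 (4,3)) +
     f (Abs_idx2 (1,2)) + f (Abs_idx2 (1,3)) + f (Abs_idx2 (2,3))"
proof -
  have I: "{p :: 4 \<times> 4. fst p < snd p} = {(4,1),(4,2),(4,3),(1,2),(1,3),(2,3)}"
    by (auto simp: set_eq_iff forall_4)
  have "sum f UNIV = sum f (Abs_idx2 ` {p. fst p < snd p})"
    using type_definition.Abs_image[OF type_definition_idx2] by simp
  also have "\<dots> = (\<Sum>p | fst p < snd p. f (Abs_idx2 p))"
    by (subst sum.reindex) (auto simp: inj_on_def Abs_idx2_inject)
  finally show ?thesis unfolding I by (simp add: add.assoc)
qed

lemma all_idx2:
  "(\<forall>i. P i) \<longleftrightarrow> P (Abs_idx2 (4,1)) \<and> P (Abs_idx2 (4,2)) \<and> P (Abs_idx2 (4,3)) \<and>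
     P (Abs_idx2 (1,2)) \<and> P (Abs_idx2 (1,3)) \<and> P (Abs_idx2 (2,3))"
proof -
  have "P i" if "P (Abs_idx2 (4,1))" "P (Abs_idx2 (4,2))" "P (Abs_idx2 (4,3))"
     "P (Abs_idx2 (1,2))" "P (Abs_idx2 (1,3))" "P (Abs_idx2 (2,3))" for i
  proof -
    obtain a b where ab: "i = Abs_idx2 (a, b)" "a < b"
      by (metis Abs_idx2_cases mem_Collect_eq prod.collapse)
    then show ?thesis
      using exhaust_4[of a] exhaust_4[of b] that by auto
  qed
  then show ?thesis by blast
qed

lemma card_idx2: "CARD(idx2) = 6"
  using sum_idx2[of "\<lambda>_. 1::nat"] by simp

text \<open>The antisymmetry of \<open>T\<close> in its last two indices cancels the factor \<open>1/2\<close> of \<open>form_op\<close>,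
  so the matrix entries of the operator are the components of \<open>T\<close>.\<close>

lemma form_op_component:
  assumes "\<And>a b c d. T a b c d = - T a b d c" "a < b"
  shows "form_op T v $ Abs_idx2 (a,b) =
     T a b 4 1 * v $ Abs_idx2 (4,1) + T a b 4 2 * v $ Abs_idx2 (4,2) +
     T a b 4 3 * v $ Abs_idx2 (4,3) + T a b 1 2 * v $ Abs_idx2 (1,2) +
     T a b 1 3 * v $ Abs_idx2 (1,3) + T a b 2 3 * v $ Abs_idx2 (2,3)"
  using assms(1)[of a b 1 4] assms(1)[of a b 2 4] assms(1)[of a b 3 4] assms(1)[of a b 2 1]
    assms(1)[of a b 3 1] assms(1)[of a b 3 2] assms(2)
  by (simp add: form_op_def Rep_Abs_idx2 sum_4 comp_def)

lemma vector_4: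
  "(vector [x, y, z, w] :: 'a::zero^4) $ 1 = x" "(vector [x, y, z, w] :: 'a::zero^4) $ 2 = y"
  "(vector [x, y, z, w] :: 'a::zero^4) $ 3 = z" "(vector [x, y, z, w] :: 'a::zero^4) $ 4 = w"
  unfolding vector_def by simp_all

lemma vol_form_swap:
  "vol_form b a c d = - vol_form a b c d" "vol_form a c b d = - vol_form a b c d"
  "vol_form a b d c = - vol_form a b c d"
proof -
  have swap: "det (\<chi> k. A $ Transposition.transpose i j k) = - det A" if "i \<noteq> j" for A :: "real^4^4" and i j
    using det_permute_rows[OF permutes_swap_id[of i UNIV j], of A] that by (simp add: sign_swap_id)
  have eqs: "(vector [axis b 1, axis a 1, axis c 1, axis d 1] :: real^4^4) =
      (\<chi> k. vector [axis a 1, axis b 1, axis c 1, axis d 1] $ Transposition.transpose 1 2 k)"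
    "(vector [axis a 1, axis c 1, axis b 1, axis d 1] :: real^4^4) =
      (\<chi> k. vector [axis a 1, axis b 1, axis c 1, axis d 1] $ Transposition.transpose 2 3 k)"
    "(vector [axis a 1, axis b 1, axis d 1, axis c 1] :: real^4^4) =
      (\<chi> k. vector [axis a 1, axis b 1, axis c 1, axis d 1] $ Transposition.transpose 3 4 k)"
    by (simp_all only: vec_eq_iff[where 'a = "real^4"] forall_4)
      (simp_all add: vector_4 Transposition.transpose_def)
  show "vol_form b a c d = - vol_form a b c d" "vol_form a c b d = - vol_form a b c d"
    "vol_form a b d c = - vol_form a b c d"
    unfolding vol_form_def eqs by (simp_all add: swap)
qed

lemma vol_form_1234: "vol_form 1 2 3 4 = 1"
proof -
  have "(vector [axis 1 1, axis 2 1, axis 3 1, axis 4 1] :: real^4^4) = mat 1"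
    by (simp only: vec_eq_iff forall_4 vector_4) (simp add: mat_def axis_def)
  then show ?thesis by (simp add: vol_form_def)
qed

text \<open>Together with \<open>vol_form_repeat\<close>, these are all the components of the volume form that
  occur in the matrix of the Hodge star on ordered pairs of indices.\<close>

lemma vol_form_pairs:
  "vol_form 4 1 2 3 = -1" "vol_form 4 2 1 3 = 1" "vol_form 4 3 1 2 = -1"
  "vol_form 1 2 4 3 = -1" "vol_form 1 3 4 2 = 1" "vol_form 2 3 4 1 = -1"
proof -
  have 1: "vol_form 1 2 4 3 = -1" using vol_form_swap(3)[of 1 2 4 3] vol_form_1234 by simp
  have "vol_form 1 4 2 3 = 1" using vol_form_swap(2)[of 1 4 2 3] 1 by simp
  then have 2: "vol_form 4 1 2 3 = -1" using vol_form_swap(1)[of 4 1 2 3] by simp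
  then have 3: "vol_form 4 2 1 3 = 1" using vol_form_swap(2)[of 4 2 1 3] by simp
  have "vol_form 4 1 3 2 = 1" using vol_form_swap(3)[of 4 1 3 2] 2 by simp
  then have 4: "vol_form 4 3 1 2 = -1" using vol_form_swap(2)[of 4 3 1 2] by simp
  have "vol_form 1 3 2 4 = -1" using vol_form_swap(2)[of 1 3 2 4] vol_form_1234 by simp
  then have 5: "vol_form 1 3 4 2 = 1" using vol_form_swap(3)[of 1 3 4 2] by simp
  have "vol_form 2 1 3 4 = -1" using vol_form_swap(1)[of 2 1 3 4] vol_form_1234 by simp
  then have "vol_form 2 3 1 4 = 1" using vol_form_swap(2)[of 2 3 1 4] by simp
  then have 6: "vol_form 2 3 4 1 = -1" using vol_form_swap(3)[of 2 3 4 1] by simp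
  show "vol_form 4 1 2 3 = -1" "vol_form 4 2 1 3 = 1" "vol_form 4 3 1 2 = -1"
    "vol_form 1 2 4 3 = -1" "vol_form 1 3 4 2 = 1" "vol_form 2 3 4 1 = -1"
    by (fact 2 3 4 1 5 6)+
qed

lemma vol_form_repeat:
  "vol_form a a c d = 0" "vol_form a b a d = 0" "vol_form a b c a = 0"
  "vol_form a b b d = 0" "vol_form a b c b = 0" "vol_form a b c c = 0"
proof -
  show 1: "vol_form a a c d = 0" for c d using vol_form_swap(1)[of a a c d] by simp
  show 2: "vol_form a b a d = 0" for d using vol_form_swap(2)[of a a b d] 1 by simp
  show "vol_form a b c a = 0" using vol_form_swap(3)[of a b c a] 2 by simp
  show 3: "vol_form a b b d = 0" for d using vol_form_swap(2)[of a b b d] by simp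
  show "vol_form a b c b = 0" using vol_form_swap(3)[of a b c b] 3 by simp
  show "vol_form a b c c = 0" using vol_form_swap(3)[of a b c c] by simp
qed

text \<open>The Hodge star exchanges the planes of complementary index pairs. The least index is
  \<open>4\<close>, so the basis contains \<open>e\<^sub>4 \<and> e\<^sub>a\<close> and not \<open>e\<^sub>a \<and> e\<^sub>4\<close>; this decides the signs.\<close>

lemma star_component:
  "form_op vol_form v $ Abs_idx2 (4,1) = - v $ Abs_idx2 (2,3)"
  "form_op vol_form v $ Abs_idx2 (4,2) = v $ Abs_idx2 (1,3)"
  "form_op vol_form v $ Abs_idx2 (4,3) = - v $ Abs_idx2 (1,2)"
  "form_op vol_form v $ Abs_idx2 (1,2) = - v $ Abs_idx2 (4,3)"
  "form_op vol_form v $ Abs_idx2 (1,3) = v $ Abs_idx2 (4,2)"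
  "form_op vol_form v $ Abs_idx2 (2,3) = - v $ Abs_idx2 (4,1)"
  by (simp_all add: form_op_component[of vol_form, OF vol_form_swap(3)] vol_form_pairs vol_form_repeat)

lemma linear_form_op: "linear (form_op T)"
proof (rule linearI)
  have c: "comp (u + v) c d = comp u c d + comp v c d" "comp (r *\<^sub>R v) c d = r * comp v c d" for u v c d r
    by (auto simp: comp_def)
  show "form_op T (u + v) = form_op T u + form_op T v" "form_op T (r *\<^sub>R v) = r *\<^sub>R form_op T v" for u v r
    by (auto simp: form_op_def vec_eq_iff c sum.distrib algebra_simps sum_distrib_left split: prod.splits)
qed

lemma form_op_selfadjoint:
  assumes "\<And>a b c d. T a b c d = - T b a c d" "\<And>a b c d. T a b c d = T c d a b"
  shows "u \<bullet> form_op T v = form_op T u \<bullet> v"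
proof -
  have T: "T a b c d = - T a b d c" for a b c d using assms by metis
  have pairs: "T 4 2 4 1 = T 4 1 4 2" "T 4 3 4 1 = T 4 1 4 3" "T 4 3 4 2 = T 4 2 4 3"
    "T 1 2 4 1 = T 4 1 1 2" "T 1 2 4 2 = T 4 2 1 2" "T 1 2 4 3 = T 4 3 1 2"
    "T 1 3 4 1 = T 4 1 1 3" "T 1 3 4 2 = T 4 2 1 3" "T 1 3 4 3 = T 4 3 1 3"
    "T 2 3 4 1 = T 4 1 2 3" "T 2 3 4 2 = T 4 2 2 3" "T 2 3 4 3 = T 4 3 2 3"
    "T 1 3 1 2 = T 1 2 1 3" "T 2 3 1 2 = T 1 2 2 3" "T 2 3 1 3 = T 1 3 2 3"
    by (rule assms(2))+
  show ?thesis
    unfolding inner_vec_def sum_idx2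
    by (simp add: form_op_component[OF T] pairs) (simp add: algebra_simps)
qed

lemma star_selfadjoint: "u \<bullet> form_op vol_form v = form_op vol_form u \<bullet> v"
  by (simp add: inner_vec_def sum_idx2 star_component)

lemma star_involution: "form_op vol_form (form_op vol_form v) = v"
  by (simp add: vec_eq_iff all_idx2 star_component)

text \<open>Up to a constant factor, this quadratic form is the Pluecker form.\<close>

lemma inner_star:
  "v \<bullet> form_op vol_form v = - 2 * (v $ Abs_idx2 (4,1) * v $ Abs_idx2 (2,3)
     - v $ Abs_idx2 (4,2) * v $ Abs_idx2 (1,3) + v $ Abs_idx2 (4,3) * v $ Abs_idx2 (1,2))"
  by (simp add: inner_vec_def sum_idx2 star_component algebra_simps)

text \<open>The difference of the two sides is antisymmetric in the four indices. It vanishes if two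
  indices coincide, and otherwise it is a constant multiple of the quadratic form in
  \<open>inner_star\<close>.\<close>

lemma pluecker:
  assumes "v \<bullet> form_op vol_form v = 0"
  shows "comp v a b * comp v c d = comp v a c * comp v b d - comp v a d * comp v b c"
proof -
  define x y z x' y' z' where defs: "x = v $ Abs_idx2 (4,1)" "y = v $ Abs_idx2 (4,2)" "z = v $ Abs_idx2 (4,3)"
    "x' = v $ Abs_idx2 (2,3)" "y' = v $ Abs_idx2 (1,3)" "z' = v $ Abs_idx2 (1,2)"
  have eq: "x * x' = y * y' - z * z'"
    using assms by (simp add: inner_star defs)
  have comps: "comp v 4 1 = x" "comp v 4 2 = y" "comp v 4 3 = z" "comp v 2 3 = x'"
    "comp v 1 3 = y'" "comp v 1 2 = z'" "comp v 1 4 = -x" "comp v 2 4 = -y" "comp v 3 4 = -z"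
    "comp v 3 2 = -x'" "comp v 3 1 = -y'" "comp v 2 1 = -z'"
    "comp v 1 1 = 0" "comp v 2 2 = 0" "comp v 3 3 = 0" "comp v 4 4 = 0"
    by (simp_all add: comp_def defs)
  have "\<forall>a b c d. comp v a b * comp v c d = comp v a c * comp v b d - comp v a d * comp v b c"
    unfolding forall_4 comps using eq by (simp add: mult.commute)
  then show ?thesis by blast
qed

text \<open>For the construction of the factors choose a component \<open>v\<^sub>a\<^sub>b \<noteq> 0\<close>. Contracting \<open>v\<close> with
  the basis vectors \<open>e\<^sub>a\<close> and \<open>e\<^sub>b\<close> gives two 1-forms in the plane of \<open>v\<close>, and the Pluecker
  relation says precisely that their wedge product is \<open>v\<^sub>a\<^sub>b v\<close>.\<close>

lemma decomposable_iff: "(\<exists>A B. v = wedge A B) \<longleftrightarrow> v \<bullet> form_op vol_form v = 0"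
proof
  assume "\<exists>A B. v = wedge A B"
  then show "v \<bullet> form_op vol_form v = 0"
    by (auto simp: inner_star wedge_def Rep_Abs_idx2 algebra_simps)
next
  assume 0: "v \<bullet> form_op vol_form v = 0"
  show "\<exists>A B. v = wedge A B"
  proof (cases "v = 0")
    case True
    then have "v = wedge 0 0" by (simp add: wedge_def vec_eq_iff split: prod.splits)
    then show ?thesis by blast
  next
    case False
    then obtain i where i: "v $ i \<noteq> 0" by (auto simp: vec_eq_iff)
    obtain a b where ab: "i = Abs_idx2 (a, b)" "a < b"
      by (metis Abs_idx2_cases mem_Collect_eq prod.collapse)
    have pl: "comp v a b * comp v c d = comp v a c * comp v b d - comp v a d * comp v b c" for c d
      using pluecker[OF 0] .
    have nz: "comp v a b \<noteq> 0" using i ab by (simp add: comp_def)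
    have "v = wedge (\<chi> c. comp v a c / comp v a b) (\<chi> c. comp v b c)"
    proof (simp only: vec_eq_iff, rule allI)
      fix j
      obtain c d where cd: "j = Abs_idx2 (c, d)" "c < d"
        by (metis Abs_idx2_cases mem_Collect_eq prod.collapse)
      have "v $ j = comp v c d" using cd by (simp add: comp_def)
      also have "\<dots> = (comp v a c * comp v b d - comp v a d * comp v b c) / comp v a b"
        using pl[of c d] nz by (simp add: field_simps)
      finally show "v $ j = wedge (\<chi> c. comp v a c / comp v a b) (\<chi> c. comp v b c) $ j"
        using cd by (simp add: wedge_def Rep_Abs_idx2 diff_divide_distrib)
    qed
    then show ?thesis by blast
  qed
qed

lemma S2_iff: "v \<in> S2 \<longleftrightarrow> v \<bullet> v = 1 \<and> v \<bullet> form_op vol_form v = 0"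
  by (simp add: S2_def decomposable_iff)


section \<open>Critical points of the sectional curvature\<close>

lemma has_derivative_sec_curv_along:
  assumes sym: "\<And>u v. u \<bullet> form_op R v = form_op R u \<bullet> v"
    and g: "(\<gamma> has_vector_derivative \<gamma>') (at t)"
  shows "((\<lambda>t. sec_curv R (\<gamma> t)) has_real_derivative 2 * (\<gamma>' \<bullet> form_op R (\<gamma> t))) (at t)"
proof -
  have "((\<lambda>t. form_op R (\<gamma> t)) has_vector_derivative form_op R \<gamma>') (at t)"
    using bounded_linear.has_vector_derivative[OF linear_conv_bounded_linear[THEN iffD1, OF linear_form_op] g] .
  from bounded_bilinear.has_vector_derivative[OF bounded_bilinear_inner g this]
  show ?thesis
    using sym[of "\<gamma> t" \<gamma>'] unfolding sec_curv_def has_real_derivative_iff_has_vector_derivative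
    by (simp add: inner_commute)
qed

text \<open>In terms of the self-dual and anti-self-dual parts of \<open>v\<close>, which have norm \<open>1/\<sqrt>2\<close> on
  \<open>S2\<close>, the set \<open>S2\<close> is a product of two spheres. A curve with a prescribed velocity is
  obtained by moving both parts along straight lines and rescaling each of them to its sphere;
  since the lines are tangent, the scaling factors have derivative 0 at the start and do not
  change the velocity.\<close>

lemma tangent_curve:
  assumes v: "v \<in> S2" and u: "u \<bullet> v = 0" "u \<bullet> form_op vol_form v = 0"
  obtains \<gamma> where "range \<gamma> \<subseteq> S2" "\<gamma> 0 = v" "(\<gamma> has_vector_derivative u) (at (0::real))"
proof -
  define K where "K = form_op vol_form"
  interpret K: linear K unfolding K_def by (rule linear_form_op)
  have KK: "K (K x) = x" and Ks: "x \<bullet> K y = K x \<bullet> y" for x y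
    by (simp_all add: K_def star_involution star_selfadjoint)
  have K4: "K x \<bullet> K y = x \<bullet> y" for x y by (metis KK Ks)
  have v0: "v \<bullet> v = 1" "v \<bullet> K v = 0" using v by (simp_all add: S2_iff K_def)
  have u0: "u \<bullet> K v = 0" using u(2) by (simp add: K_def)
  have Kv: "K v \<bullet> v = 0" "K v \<bullet> u = 0" using v0 u0 by (simp_all add: inner_commute)
  have Ku: "K u \<bullet> v = 0" "v \<bullet> K u = 0" using Ks[of u v] Ks[of v u] u0 Kv by simp_all
  have "v \<bullet> u = 0" using u(1) by (simp add: inner_commute)
  note v1 = v0 u0 Kv Ku this
  define pv mv pu mu where defs: "pv = (1/2) *\<^sub>R (v + K v)" "mv = (1/2) *\<^sub>R (v - K v)"
     "pu = (1/2) *\<^sub>R (u + K u)" "mu = (1/2) *\<^sub>R (u - K u)"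
  have Kp: "K pv = pv" "K pu = pu" "K mv = - mv" "K mu = - mu"
    by (simp_all add: defs K.scaleR K.add K.diff KK add.commute flip: scaleR_minus_right)
  have orth: "p \<bullet> m = 0" "m \<bullet> p = 0" if "K p = p" "K m = - m" for p m
    using Ks[of p m] that by (simp_all add: inner_commute)
  have norms: "pv \<bullet> pv = 1/2" "mv \<bullet> mv = 1/2" "pv \<bullet> pu = 0" "mv \<bullet> mu = 0"
    using v1 u by (simp_all add: defs inner_simps K4)
  \<comment> \<open>The factors that bring the moved parts back to norm \<open>1/\<sqrt>2\<close>.\<close>
  define a b where "a t = 1 / sqrt (1 + 2 * t\<^sup>2 * (pu \<bullet> pu))" and "b t = 1 / sqrt (1 + 2 * t\<^sup>2 * (mu \<bullet> mu))" for t :: real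
  have ab0: "a 0 = 1" "b 0 = 1" by (simp_all add: a_def b_def)
  have pos: "1 + 2 * t\<^sup>2 * (x \<bullet> x) > 0" for t :: real and x :: form2
    by (smt (verit) inner_ge_zero mult_nonneg_nonneg zero_le_power2)
  have a2: "(a t)\<^sup>2 * (1/2 + t\<^sup>2 * (pu \<bullet> pu)) = 1/2" and b2: "(b t)\<^sup>2 * (1/2 + t\<^sup>2 * (mu \<bullet> mu)) = 1/2" for t
    using pos[of t pu] pos[of t mu] by (simp_all add: a_def b_def power_divide field_simps)
  define \<gamma> where "\<gamma> t = a t *\<^sub>R (pv + t *\<^sub>R pu) + b t *\<^sub>R (mv + t *\<^sub>R mu)" for t
  have "\<gamma> t \<in> S2" for t
  proof -
    let ?p = "a t *\<^sub>R (pv + t *\<^sub>R pu)" and ?m = "b t *\<^sub>R (mv + t *\<^sub>R mu)"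
    have K: "K ?p = ?p" "K ?m = - ?m"
      by (simp_all add: K.scaleR K.add Kp flip: scaleR_minus_right)
    have "?p \<bullet> ?p = (a t)\<^sup>2 * (1/2 + t\<^sup>2 * (pu \<bullet> pu))" "?m \<bullet> ?m = (b t)\<^sup>2 * (1/2 + t\<^sup>2 * (mu \<bullet> mu))"
      using norms by (simp_all add: inner_simps inner_commute power2_eq_square algebra_simps)
    then have n: "?p \<bullet> ?p = 1/2" "?m \<bullet> ?m = 1/2" by (simp_all only: a2 b2)
    have "\<gamma> t \<bullet> \<gamma> t = ?p \<bullet> ?p + ?m \<bullet> ?m + 2 * (?p \<bullet> ?m)"
      unfolding \<gamma>_def by (simp only: inner_add_left inner_add_right inner_commute[of ?m ?p])
    then have "\<gamma> t \<bullet> \<gamma> t = 1" using n orth(1)[OF K] by linarith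
    moreover have "\<gamma> t \<bullet> K (\<gamma> t) = ?p \<bullet> ?p - ?m \<bullet> ?m"
      unfolding \<gamma>_def K.add K
      by (simp only: inner_add_left inner_add_right inner_commute[of ?m ?p] inner_minus_right)
    ultimately show ?thesis using n by (simp add: S2_iff K_def)
  qed
  then have "range \<gamma> \<subseteq> S2" by auto
  moreover have "\<gamma> 0 = v" by (simp add: \<gamma>_def ab0 defs algebra_simps flip: scaleR_add_left)
  moreover have "(\<gamma> has_vector_derivative u) (at 0)"
  proof -
    have da: "(a has_real_derivative 0) (at 0)" "(b has_real_derivative 0) (at 0)"
      unfolding a_def b_def by (auto intro!: derivative_eq_intros)
    have l: "((\<lambda>t. x + t *\<^sub>R y) has_vector_derivative y) (at 0)" for x y :: form2
      by (auto intro!: derivative_eq_intros)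
    have "(\<gamma> has_vector_derivative (a 0 *\<^sub>R pu + 0 *\<^sub>R (pv + 0 *\<^sub>R pu)) + (b 0 *\<^sub>R mu + 0 *\<^sub>R (mv + 0 *\<^sub>R mu))) (at 0)"
      unfolding \<gamma>_def
      by (intro has_vector_derivative_add has_vector_derivative_scaleR da l)
    moreover have "pu + mu = u" by (simp add: defs algebra_simps flip: scaleR_add_left)
    ultimately show ?thesis by (simp add: ab0)
  qed
  ultimately show thesis by (rule that)
qed

text \<open>Lagrange multipliers for the constraints \<open>v \<bullet> v = 1\<close> and \<open>v \<bullet> K v = 0\<close>. The derivative
  of the sectional curvature in the direction \<open>u\<close> is \<open>2 (u \<bullet> R v)\<close>; it vanishes for all
  tangent \<open>u\<close> exactly if \<open>R v\<close> lies in the span of the normal vectors \<open>v\<close> and \<open>K v\<close>.\<close>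

lemma critical_point_iff:
  assumes sym: "\<And>u v. u \<bullet> form_op R v = form_op R u \<bullet> v"
  shows "critical_point_on S2 (sec_curv R) v \<longleftrightarrow>
    v \<in> S2 \<and> (\<exists>x y. form_op R v = x *\<^sub>R v + y *\<^sub>R form_op vol_form v)"
proof
  assume cr: "critical_point_on S2 (sec_curv R) v"
  then have v: "v \<in> S2" by (simp add: critical_point_on_def)
  have tang: "u \<bullet> form_op R v = 0" if u: "u \<bullet> v = 0" "u \<bullet> form_op vol_form v = 0" for u
  proof -
    obtain \<gamma> where g: "range \<gamma> \<subseteq> S2" "\<gamma> 0 = v" "(\<gamma> has_vector_derivative u) (at (0::real))"
      using tangent_curve[OF v u] .
    then have "((\<lambda>t. sec_curv R (\<gamma> t)) has_real_derivative 0) (at 0)"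
      using cr by (auto simp: critical_point_on_def)
    from DERIV_unique[OF this has_derivative_sec_curv_along[OF sym g(3)]] g(2) show ?thesis by simp
  qed
  let ?K = "form_op vol_form"
  define x y where "x = v \<bullet> form_op R v" and "y = ?K v \<bullet> form_op R v"
  \<comment> \<open>The component of \<open>R v\<close> orthogonal to both normal vectors is itself tangent.\<close>
  define u where "u = form_op R v - x *\<^sub>R v - y *\<^sub>R ?K v"
  have v1: "v \<bullet> v = 1" "v \<bullet> ?K v = 0" "?K v \<bullet> v = 0" "?K v \<bullet> ?K v = 1"
    using v star_selfadjoint[of v "?K v"] by (simp_all add: S2_iff star_involution inner_commute)
  have u: "u \<bullet> v = 0" "u \<bullet> ?K v = 0"
    by (simp_all only: u_def inner_diff_left inner_scaleR_left v1 x_def y_def) (simp_all add: inner_commute)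
  have "u \<bullet> u = u \<bullet> form_op R v - x * (u \<bullet> v) - y * (u \<bullet> ?K v)"
    by (subst (2) u_def) (simp add: inner_diff_right)
  then have "u = 0" using tang[OF u] u by simp
  then have "form_op R v = x *\<^sub>R v + y *\<^sub>R ?K v" by (simp add: u_def algebra_simps)
  with v show "v \<in> S2 \<and> (\<exists>x y. form_op R v = x *\<^sub>R v + y *\<^sub>R ?K v)" by blast
next
  let ?K = "form_op vol_form"
  assume "v \<in> S2 \<and> (\<exists>x y. form_op R v = x *\<^sub>R v + y *\<^sub>R ?K v)"
  then obtain x y where v: "v \<in> S2" and xy: "form_op R v = x *\<^sub>R v + y *\<^sub>R ?K v" by blast
  show "critical_point_on S2 (sec_curv R) v"
    unfolding critical_point_on_def
  proof (intro conjI allI impI v, elim conjE)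
    fix \<gamma> :: "real \<Rightarrow> form2" and u
    assume g: "range \<gamma> \<subseteq> S2" "\<gamma> 0 = v" "(\<gamma> has_vector_derivative u) (at 0)"
    have gS: "\<gamma> t \<in> S2" for t using g(1) by blast
    have "((\<lambda>t. \<gamma> t \<bullet> \<gamma> t) has_vector_derivative \<gamma> 0 \<bullet> u + u \<bullet> \<gamma> 0) (at 0)"
      by (rule bounded_bilinear.has_vector_derivative[OF bounded_bilinear_inner g(3) g(3)])
    then have "(\<gamma> 0 \<bullet> u + u \<bullet> \<gamma> 0) = 0"
      using gS unfolding S2_iff
      by (simp add: vector_derivative_unique_at[OF _ has_vector_derivative_const])
    then have 1: "u \<bullet> v = 0" using g(2) by (simp add: inner_commute)
    \<comment> \<open>The constraint \<open>v \<bullet> K v = 0\<close> is the sectional curvature of the volume form, so the same derivative rule applies.\<close>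
    have "((\<lambda>t. sec_curv vol_form (\<gamma> t)) has_real_derivative 2 * (u \<bullet> ?K (\<gamma> 0))) (at 0)"
      by (rule has_derivative_sec_curv_along[OF star_selfadjoint g(3)])
    moreover have "sec_curv vol_form (\<gamma> t) = 0" for t
      using gS[of t] by (simp add: S2_iff sec_curv_def)
    ultimately have "((\<lambda>t. 0) has_real_derivative 2 * (u \<bullet> ?K (\<gamma> 0))) (at 0)" by simp
    from DERIV_unique[OF this DERIV_const] have 2: "u \<bullet> ?K v = 0" using g(2) by simp
    show "((\<lambda>t. sec_curv R (\<gamma> t)) has_real_derivative 0) (at 0)"
      using has_derivative_sec_curv_along[OF sym g(3)] g(2) 1 2 by (simp add: xy inner_add_right)
  qed
qed

lemma sec_curv_multiplier:
  assumes "v \<in> S2" "form_op R v = x *\<^sub>R v + y *\<^sub>R form_op vol_form v"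
  shows "sec_curv R v = x"
  using assms by (simp add: sec_curv_def inner_add_right S2_iff)

lemma critical_minimum:
  assumes sym: "\<And>u v. u \<bullet> form_op R v = form_op R u \<bullet> v"
  shows "\<exists>v. critical_point_on S2 (sec_curv R) v \<and> (\<forall>w\<in>S2. sec_curv R v \<le> sec_curv R w)"
proof -
  have cont: "continuous_on S (form_op T)" for S T
    using linear_continuous_on linear_conv_bounded_linear linear_form_op by blast
  have S2: "S2 = {v. norm v = 1 \<and> sec_curv vol_form v = 0}"
    by (auto simp: S2_iff sec_curv_def norm_eq_1)
  have csc: "continuous_on S (sec_curv T)" for S T
    unfolding sec_curv_def[abs_def] by (intro continuous_intros cont)
  have "closed S2"
    unfolding S2 by (intro closed_Collect_conj closed_Collect_eq continuous_intros csc)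
  moreover have "bounded S2" unfolding bounded_iff S2 by auto
  ultimately have "compact S2" by (simp add: compact_eq_bounded_closed)
  moreover have "axis (Abs_idx2 (1,2)) 1 \<in> S2"
    by (simp add: S2_iff inner_star inner_axis_axis) (simp add: axis_def Abs_idx2_inject)
  ultimately obtain v where v: "v \<in> S2" "\<And>w. w \<in> S2 \<Longrightarrow> sec_curv R v \<le> sec_curv R w"
    using continuous_attains_inf[OF _ _ csc, of S2] by blast
  have "critical_point_on S2 (sec_curv R) v"
    unfolding critical_point_on_def
  proof (intro conjI allI impI v, elim conjE)
    fix \<gamma> :: "real \<Rightarrow> form2" and u
    assume g: "range \<gamma> \<subseteq> S2" "\<gamma> 0 = v" "(\<gamma> has_vector_derivative u) (at 0)"
    note d = has_derivative_sec_curv_along[OF sym g(3)]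
    have "2 * (u \<bullet> form_op R (\<gamma> 0)) = 0"
      using g v(2) by (intro DERIV_local_min[OF d, of 1]) auto
    with d show "((\<lambda>t. sec_curv R (\<gamma> t)) has_real_derivative 0) (at 0)" by simp
  qed
  with v(2) show ?thesis by blast
qed


section \<open>The derivative of the determinant at a singular matrix\<close>

lemma det_has_derivative:
  fixes M :: "real^'n^'n"
  obtains L where "(det has_derivative L) (at M)"
proof -
  have "(det has_derivative (\<lambda>N. \<Sum>p | p permutes (UNIV::'n set). of_int (sign p) *
      (\<Sum>i\<in>UNIV. N $ i $ p i * (\<Prod>j\<in>UNIV - {i}. M $ j $ p j)))) (at M)"
    unfolding det_def[abs_def]
    by (intro has_derivative_sum has_derivative_mult_right has_derivative_prod
        bounded_linear_imp_has_derivative bounded_linear_compose[OF bounded_linear_vec_nth bounded_linear_vec_nth])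
  then show thesis by (rule that)
qed

text \<open>Along the line \<open>M + t N\<close> all matrices are singular, so the determinant is constant
  there.\<close>

lemma det_derivative_common_kernel:
  fixes M N :: "real^'n^'n"
  assumes L: "(det has_derivative L) (at M)" and w: "w \<noteq> 0" "M *v w = 0" "N *v w = 0"
  shows "L N = 0"
proof -
  have 0: "det (M + t *\<^sub>R N) = 0" for t
  proof -
    have "(M + t *\<^sub>R N) *v w = 0"
      using w by (simp add: matrix_vector_mult_add_rdistrib scaleR_matrix_vector_assoc[symmetric])
    then show ?thesis
      using w(1) by (metis invertible_det_nz matrix_left_invertible_ker invertible_def)
  qed
  have "((\<lambda>t. M + t *\<^sub>R N) has_derivative (\<lambda>t. t *\<^sub>R N)) (at 0)"
    by (auto intro!: derivative_eq_intros)
  moreover have "(det has_derivative L) (at (M + 0 *\<^sub>R N))" using L by simp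
  ultimately have "((\<lambda>t. det (M + t *\<^sub>R N)) has_derivative (\<lambda>t. L (t *\<^sub>R N))) (at 0)"
    by (rule has_derivative_compose[where g = det])
  then have "(\<lambda>t. L (t *\<^sub>R N)) = (\<lambda>t. 0)"
    unfolding 0 by (rule has_derivative_unique) simp
  from fun_cong[OF this, of 1] show ?thesis by simp
qed

lemma det_derivative_common_left_kernel:
  fixes M N :: "real^'n^'n"
  assumes L: "(det has_derivative L) (at M)" and u: "u \<noteq> 0" "u v* M = 0" "u v* N = 0"
  shows "L N = 0"
proof -
  interpret T: linear "transpose :: real^'n^'n \<Rightarrow> _"
    by (rule linearI) (simp_all add: transpose_def vec_eq_iff)
  have T: "(transpose has_derivative transpose) (at (transpose M))"
    by (intro bounded_linear_imp_has_derivative linear_conv_bounded_linear[THEN iffD1] T.linear_axioms)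
  have "(det has_derivative L) (at (transpose (transpose M)))" using L by simp
  from has_derivative_compose[OF T this]
  have "(det has_derivative (\<lambda>N. L (transpose N))) (at (transpose M))" by (simp add: o_def)
  from det_derivative_common_kernel[OF this u(1), of "transpose N"] u(2,3) show ?thesis
    by (simp add: transpose_matrix_vector)
qed

text \<open>A form of Jacobi's formula that avoids the adjugate matrix. Subtracting from \<open>N\<close> a
  matrix that kills \<open>w\<close> does not change \<open>L N\<close>, which leaves a multiple of the rank one matrix
  with column vector \<open>z = N w\<close> and row vector \<open>w\<close>. Its derivative is linear in \<open>z\<close> and
  vanishes if \<open>u \<bullet> z = 0\<close>, since \<open>u\<close> is then a common left kernel vector; so it is a multiple
  of \<open>u \<bullet> z\<close>.\<close>

lemma det_derivative_singular:
  fixes M :: "real^'n^'n"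
  assumes L: "(det has_derivative L) (at M)"
    and w: "w \<noteq> 0" "M *v w = 0" and u: "u \<noteq> 0" "u v* M = 0"
  obtains c where "\<And>N. L N = c * (u \<bullet> (N *v w))"
proof -
  define out where "out z = (\<chi> i j. z $ i * w $ j)" for z :: "real^'n"
  have out_w: "out z *v w = (w \<bullet> w) *\<^sub>R z" for z
    by (simp add: out_def matrix_vector_mult_def vec_eq_iff inner_vec_def sum_distrib_left sum_distrib_right mult_ac)
  have out_u: "u v* out z = (u \<bullet> z) *\<^sub>R w" for z
    by (simp add: out_def vector_matrix_mult_def vec_eq_iff inner_vec_def sum_distrib_left sum_distrib_right mult_ac)
  interpret L: linear L using L by (simp add: has_derivative_linear)
  \<comment> \<open>The value that the formula must give for \<open>N = out u\<close>.\<close>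
  define c where "c = L (out u) / ((u \<bullet> u) * (w \<bullet> w))"
  have "L N = c * (u \<bullet> (N *v w))" for N
  proof -
    define z where "z = N *v w"
    define y where "y = z - ((u \<bullet> z) / (u \<bullet> u)) *\<^sub>R u"
    have "L (N - (1 / (w \<bullet> w)) *\<^sub>R out z) = 0"
      by (rule det_derivative_common_kernel[OF L w])
        (use w in \<open>simp add: matrix_vector_mult_diff_rdistrib scaleR_matrix_vector_assoc[symmetric] out_w z_def\<close>)
    then have 1: "L N = L (out z) / (w \<bullet> w)" by (simp add: L.diff L.scaleR)
    have "u \<bullet> y = 0" using u by (simp add: y_def inner_diff_right)
    then have "L (out y) = 0"
      by (intro det_derivative_common_left_kernel[OF L u]) (simp add: out_u)
    moreover have "out y = out z - ((u \<bullet> z) / (u \<bullet> u)) *\<^sub>R out u"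
      by (simp add: out_def y_def vec_eq_iff algebra_simps)
    ultimately have "L (out z) = (u \<bullet> z) / (u \<bullet> u) * L (out u)" by (simp add: L.diff L.scaleR)
    with 1 show ?thesis by (simp add: c_def z_def)
  qed
  then show thesis by (rule that)
qed

lemma singular_left_kernel:
  fixes M :: "real^'n^'n"
  assumes "w \<noteq> 0" "M *v w = 0"
  obtains u where "u \<noteq> 0" "u v* M = 0"
proof -
  have "det M = 0"
    using assms by (metis invertible_det_nz matrix_left_invertible_ker invertible_def)
  then have "\<not> invertible (transpose M)" by (simp add: invertible_det_nz)
  then have "\<not> (\<forall>x. transpose M *v x = 0 \<longrightarrow> x = 0)"
    by (metis invertible_left_inverse matrix_left_invertible_ker)
  then show thesis using that by (auto simp: transpose_matrix_vector)
qed

text \<open>In a two-dimensional kernel there is, for any left kernel vector \<open>u\<close>, a nonzero \<open>w\<close> with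
  \<open>u \<bullet> N w = 0\<close>.\<close>

lemma det_derivative_corank_2:
  fixes M :: "real^'n^'n"
  assumes L: "(det has_derivative L) (at M)"
    and w: "M *v w1 = 0" "M *v w2 = 0"
    and indep: "\<And>a b. a *\<^sub>R w1 + b *\<^sub>R w2 = 0 \<Longrightarrow> a = 0 \<and> b = 0"
  shows "L N = 0"
proof -
  have "w1 \<noteq> 0" using indep[of 1 0] by auto
  from singular_left_kernel[OF this w(1)] obtain u where u: "u \<noteq> 0" "u v* M = 0" .
  obtain a b where ab: "a * (u \<bullet> (N *v w1)) + b * (u \<bullet> (N *v w2)) = 0" "a \<noteq> 0 \<or> b \<noteq> 0"
  proof (cases "u \<bullet> (N *v w2) = 0")
    case True
    then show ?thesis using that[of 0 1] by simp
  next
    case False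
    then show ?thesis using that[of "u \<bullet> (N *v w2)" "- (u \<bullet> (N *v w1))"] by simp
  qed
  define w where "w = a *\<^sub>R w1 + b *\<^sub>R w2"
  have "w \<noteq> 0" unfolding w_def using indep[of a b] ab(2) by blast
  moreover have "M *v w = 0" using w by (simp add: w_def matrix_vector_right_distrib matrix_vector_mult_scaleR)
  ultimately obtain c where c: "\<And>N. L N = c * (u \<bullet> (N *v w))"
    using det_derivative_singular[OF L _ _ u] by blast
  have "u \<bullet> (N *v w) = a * (u \<bullet> (N *v w1)) + b * (u \<bullet> (N *v w2))"
    by (simp add: w_def matrix_vector_right_distrib matrix_vector_mult_scaleR inner_add_right)
  also have "\<dots> = 0" by (rule ab(1))
  finally show ?thesis by (simp add: c)
qed

text \<open>Every left kernel vector of \<open>M\<close> is orthogonal to the image of \<open>M\<close>.\<close>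

lemma det_derivative_kernel_image:
  fixes M N :: "real^'n^'n"
  assumes L: "(det has_derivative L) (at M)" and w: "w \<noteq> 0" "M *v w = 0"
    and N: "N *v w = M *v w'"
  shows "L N = 0"
proof -
  obtain u where u: "u \<noteq> 0" "u v* M = 0" using singular_left_kernel[OF w] .
  obtain c where c: "\<And>N. L N = c * (u \<bullet> (N *v w))"
    using det_derivative_singular[OF L w u] by blast
  have "u \<bullet> (M *v w') = (u v* M) \<bullet> w'"
    by (metis dot_lmul_matrix)
  then show ?thesis by (simp add: c N u)
qed


section \<open>Multiple roots of discriminants\<close>

lemma has_vector_derivative_matrix:
  fixes A :: "real \<Rightarrow> real^'n^'m"
  assumes "\<And>i j. ((\<lambda>x. A x $ i $ j) has_real_derivative B $ i $ j) (at x)"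
  shows "(A has_vector_derivative B) (at x)"
  using assms unfolding has_vector_derivative_def has_field_derivative_def
  by (subst has_derivative_componentwise_within) (auto simp: Basis_vec_def inner_axis mult_commute_abs)

text \<open>The two notions of determinant agree: the first is for matrices with indices below \<open>n\<close>,
  in terms of which resultants are defined, the second for matrices indexed by a finite type,
  on which the determinant can be differentiated. The bijection \<open>e\<close> numbers the elements of
  the index type.\<close>

lemma det_mat_eq_det_vec:
  fixes A :: "'a::comm_ring_1 mat" and e :: "'n::finite \<Rightarrow> nat"
  assumes A: "A \<in> carrier_mat n n" and e: "bij_betw e UNIV {0..<n}"
  shows "Determinant.det A = Determinants.det (\<chi> i j. A $$ (e i, e j))"
proof -
  let ?m = "map_permutation (UNIV::'n set) e"
  have inj: "inj e" using e by (simp add: bij_betw_def)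
  have m: "bij_betw ?m {p. p permutes UNIV} {p. p permutes {0..<n}}"
  proof (rule bij_betw_byWitness[where f' = "map_permutation {0..<n} (inv_into UNIV e)"])
    have ei: "bij_betw (inv_into UNIV e) {0..<n} UNIV" using bij_betw_inv_into[OF e] .
    show "\<forall>p\<in>{p. p permutes UNIV}. map_permutation {0..<n} (inv_into UNIV e) (?m p) = p"
      using map_permutation_compose_inv[OF e] inj by auto
    show "\<forall>p\<in>{p. p permutes {0..<n}}. ?m (map_permutation {0..<n} (inv_into UNIV e) p) = p"
      using map_permutation_compose_inv[OF ei] bij_betw_inv_into_right[OF e] by auto
    show "?m ` {p. p permutes UNIV} \<subseteq> {p. p permutes {0..<n}}"
      using map_permutation_permutes[OF e] by auto
    show "map_permutation {0..<n} (inv_into UNIV e) ` {p. p permutes {0..<n}} \<subseteq> {p. p permutes UNIV}"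
      using map_permutation_permutes[OF ei] by auto
  qed
  have "Determinant.det A = (\<Sum>p | p permutes {0..<n}. of_int (sign p) * (\<Prod>i = 0..<n. A $$ (i, p i)))"
    by (rule det_def'[OF A])
  also have "\<dots> = (\<Sum>p | p permutes (UNIV::'n set). of_int (sign (?m p)) * (\<Prod>i = 0..<n. A $$ (i, ?m p i)))"
    by (rule sum.reindex_bij_betw[OF m, symmetric])
  also have "\<dots> = (\<Sum>p | p permutes (UNIV::'n set). of_int (sign p) * (\<Prod>i\<in>UNIV. A $$ (e i, e (p i))))"
  proof (rule sum.cong[OF refl])
    fix p assume "p \<in> {p. p permutes (UNIV::'n set)}"
    then have "sign (?m p) = sign p" by (simp add: sign_map_permutation inj)
    moreover have "(\<Prod>i = 0..<n. A $$ (i, ?m p i)) = (\<Prod>i\<in>UNIV. A $$ (e i, ?m p (e i)))"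
      by (rule prod.reindex_bij_betw[OF e, symmetric])
    ultimately show "of_int (sign (?m p)) * (\<Prod>i = 0..<n. A $$ (i, ?m p i)) =
        of_int (sign p) * (\<Prod>i\<in>UNIV. A $$ (e i, e (p i)))"
      by (simp add: map_permutation_apply inj)
  qed
  finally show ?thesis by (simp add: Determinants.det_def)
qed

definition sylvester_vec :: "('n::finite \<Rightarrow> nat) \<Rightarrow> nat \<Rightarrow> nat \<Rightarrow> real poly \<Rightarrow> real poly \<Rightarrow> real^'n^'n" where
  "sylvester_vec e m n f g = (\<chi> i j. sylvester_mat_sub m n f g $$ (e i, e j))"

text \<open>The functionals of interest are the evaluation of a polynomial or of its derivative at a
  real point, and the real and imaginary parts of the evaluation at a complex number.
  Evaluation vanishes on the ideal generated by two polynomials with a common root there, and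
  evaluation of the derivative does so if that root is multiple for both of them.\<close>

definition poly_functional :: "(real poly \<Rightarrow> real) \<Rightarrow> bool" where
  "poly_functional l \<longleftrightarrow> (\<forall>p q. l (p + q) = l p + l q) \<and> (\<forall>c p. l (smult c p) = c * l p)"

lemma poly_functional_expand:
  assumes l: "poly_functional l" and h: "degree h < N"
  shows "l h = (\<Sum>k<N. coeff h k * l (monom 1 k))"
proof -
  have 0: "l 0 = 0" using l unfolding poly_functional_def by (metis mult_zero_left smult_0_left)
  have sum: "l (\<Sum>k\<in>A. f k) = (\<Sum>k\<in>A. l (f k))" if "finite A" for f and A :: "nat set"
    using that by (induction rule: finite_induct) (use l 0 in \<open>auto simp: poly_functional_def\<close>)
  have "h = (\<Sum>k<N. smult (coeff h k) (monom 1 k))"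
    using h by (intro poly_eqI) (auto simp: coeff_sum smult_monom coeff_eq_0)
  then have "l h = l (\<Sum>k<N. smult (coeff h k) (monom 1 k))" by simp
  also have "\<dots> = (\<Sum>k<N. coeff h k * l (monom 1 k))"
    using l unfolding poly_functional_def by (subst sum) auto
  finally show ?thesis .
qed

text \<open>The values of a functional at the powers of the variable, in the order of the columns of
  the Sylvester matrix, which start with the highest power \<open>N - 1\<close>.\<close>

definition moments :: "('n::finite \<Rightarrow> nat) \<Rightarrow> nat \<Rightarrow> (real poly \<Rightarrow> real) \<Rightarrow> real^'n" where
  "moments e N l = (\<chi> j. l (monom 1 (N - 1 - e j)))"

text \<open>The rows of the Sylvester matrix are the coefficients of the multiples of \<open>f\<close> and \<open>g\<close> by
  powers of the variable. Multiplying by the vector of moments of \<open>l\<close> therefore evaluates \<open>l\<close>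
  at these multiples. In particular a functional that vanishes on the ideal generated by \<open>f\<close>
  and \<open>g\<close> gives a kernel vector. The degrees of \<open>f\<close> and \<open>g\<close> may be smaller than \<open>m\<close> and \<open>n\<close>,
  as happens for derivatives with respect to a parameter.\<close>

lemma sylvester_vec_moments:
  assumes e: "bij_betw e UNIV {0..<m+n}" and l: "poly_functional l"
    and f: "degree f \<le> m" and g: "degree g \<le> n"
  shows "sylvester_vec e m n f g *v moments e (m + n) l =
    (\<chi> i. l (if e i < n then monom 1 (n - 1 - e i) * f else monom 1 (m + n - 1 - e i) * g))"
proof (simp only: vec_eq_iff, rule allI)
  fix i
  let ?N = "m + n"
  define h where "h = (if e i < n then monom 1 (n - 1 - e i) * f else monom 1 (?N - 1 - e i) * g)"
  have eN: "e j < ?N" for j using e by (auto simp: bij_betw_def)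
  have "degree h < ?N"
  proof (cases "e i < n")
    case True
    have "degree h \<le> (n - 1 - e i) + m"
      unfolding h_def using True degree_mult_le[of "monom 1 (n - 1 - e i)" f] f
      by (simp add: degree_monom_eq)
    with True show ?thesis by simp
  next
    case False
    have "degree h \<le> (?N - 1 - e i) + n"
      unfolding h_def using False degree_mult_le[of "monom 1 (?N - 1 - e i)" g] g
      by (simp add: degree_monom_eq)
    with False eN[of i] show ?thesis by simp
  qed
  note lh = poly_functional_expand[OF l this]
  have c: "sylvester_mat_sub m n f g $$ (e i, e j) = coeff h (?N - 1 - e j)" for j
    using eN[of i] eN[of j] f g
    by (auto simp: sylvester_mat_sub_index h_def coeff_monom_mult intro!: coeff_eq_0 arg_cong[where f = "coeff _"])
  have b: "bij_betw (\<lambda>j. ?N - 1 - e j) UNIV {..<?N}"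
  proof (rule bij_betw_trans[OF e, of "\<lambda>k. ?N - 1 - k", unfolded o_def])
    show "bij_betw (\<lambda>k. ?N - 1 - k) {0..<?N} {..<?N}"
      by (rule bij_betw_byWitness[where f' = "\<lambda>k. ?N - 1 - k"]) auto
  qed
  have "(sylvester_vec e m n f g *v moments e ?N l) $ i = (\<Sum>j\<in>UNIV. coeff h (?N - 1 - e j) * l (monom 1 (?N - 1 - e j)))"
    by (simp add: matrix_vector_mult_def sylvester_vec_def moments_def c)
  also have "\<dots> = (\<Sum>k<?N. coeff h k * l (monom 1 k))"
    by (rule sum.reindex_bij_betw[OF b])
  finally show "(sylvester_vec e m n f g *v moments e ?N l) $ i =
      (\<chi> i. l (if e i < n then monom 1 (n - 1 - e i) * f else monom 1 (m + n - 1 - e i) * g)) $ i"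
    using lh by (simp add: h_def[symmetric])
qed

abbreviation slice :: "real poly poly \<Rightarrow> real \<Rightarrow> real poly" where
  "slice P x \<equiv> map_poly (\<lambda>c. poly c x) P"

lemma poly_slice: "poly (slice P x) y = poly (poly P [:y:]) x"
  by (induction P) (simp_all add: map_poly_pCons)

text \<open>A constant leading coefficient keeps the size of the Sylvester matrix independent of
  \<open>x\<close>, so that the discriminant commutes with the substitution of a value for \<open>x\<close>.\<close>

lemma degree_slice:
  assumes "degree (lead_coeff P) = 0" "P \<noteq> 0"
  shows "degree (slice P x) = degree P"
proof (rule map_poly_degree_eq)
  show "poly (lead_coeff P) x \<noteq> 0"
    using assms by (auto elim!: degree_eq_zeroE)
qed

lemma pderiv_slice: "slice (pderiv P) x = pderiv (slice P x)"
  by (rule poly_hom.map_poly_pderiv)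

lemma poly_discr_slice:
  assumes "degree (lead_coeff P) = 0" "P \<noteq> 0"
  shows "poly (discr P) x = resultant (slice P x) (pderiv (slice P x))"
proof -
  have "degree (slice (pderiv P) x) = degree (pderiv P)"
    by (simp add: pderiv_slice degree_pderiv degree_slice[OF assms])
  from poly_hom.resultant_map_poly[OF degree_slice[OF assms] this]
  show ?thesis using assms by (simp add: discr_def pderiv_slice)
qed

lemma discr_eq_0_iff:
  fixes g :: "real poly"
  assumes "g \<noteq> 0"
  shows "discr g = 0 \<longleftrightarrow> degree (gcd g (pderiv g)) \<noteq> 0"
  using assms by (simp add: discr_def div_exp_Lazard_gcd.resultant_0_gcd)

lemma discr_eq_0_if_double_root:
  fixes g :: "real poly"
  assumes "poly g a = 0" "poly (pderiv g) a = 0"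
  shows "discr g = 0"
proof (cases "g = 0")
  case False
  have "[:-a, 1:] dvd gcd g (pderiv g)" using assms by (simp add: poly_eq_0_iff_dvd)
  then have "degree [:-a, 1:] \<le> degree (gcd g (pderiv g))"
    using False by (intro dvd_imp_degree_le) auto
  then show ?thesis using False by (simp add: discr_eq_0_iff)
qed (simp add: discr_def)

lemma complex_double_root_if_discr_eq_0:
  fixes g :: "real poly"
  assumes "discr g = 0" "g \<noteq> 0"
  obtains z where "poly (map_poly complex_of_real g) z = 0" "poly (map_poly complex_of_real (pderiv g)) z = 0"
proof -
  let ?C = "map_poly complex_of_real" and ?d = "gcd g (pderiv g)"
  have "degree (?C ?d) \<noteq> 0" using assms by (simp add: discr_eq_0_iff)
  then obtain z where z: "poly (?C ?d) z = 0"
    using fundamental_theorem_of_algebra[of "?C ?d"] by (auto simp: constant_degree)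
  obtain r s where "g = ?d * r" "pderiv g = ?d * s" by (meson dvdE gcd_dvd1 gcd_dvd2)
  moreover interpret C: map_poly_comm_ring_hom complex_of_real ..
  have "?C (p * q) = ?C p * ?C q" for p q by (rule C.hom_mult)
  ultimately have "?C g = ?C ?d * ?C r" "?C (pderiv g) = ?C ?d * ?C s" by metis+
  with z show thesis by (intro that[of z]) simp_all
qed

text \<open>The discriminant at \<open>x\<close> is the determinant of a Sylvester matrix whose entries are
  polynomials in \<open>x\<close>. The derivative of this matrix is the Sylvester matrix, of the same
  shape, of \<open>D = \<partial>\<^sub>x P\<close> and \<open>\<partial>\<^sub>y D\<close>; the chain rule gives the derivative of the discriminant.\<close>

lemma discr_derivative:
  fixes P :: "real poly poly" and x :: real and e :: "'n::finite \<Rightarrow> nat"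
  assumes lc: "degree (lead_coeff P) = 0" "P \<noteq> 0" and m: "m = degree P" and n: "n = degree P - 1"
    and e: "bij_betw e UNIV {0..<m+n}"
  defines "D \<equiv> map_poly (\<lambda>c. poly (pderiv c) x) P"
  obtains L where "(Determinants.det has_derivative L) (at (sylvester_vec e m n (slice P x) (pderiv (slice P x))))"
    "poly (pderiv (discr P)) x = L (sylvester_vec e m n D (pderiv D))"
proof -
  let ?A = "\<lambda>x. sylvester_vec e m n (slice P x) (pderiv (slice P x))"
  let ?N = "sylvester_vec e m n D (pderiv D)"
  have eN: "e j < m + n" for j using e by (auto simp: bij_betw_def)
  have det_A: "Determinants.det (?A t) = poly (discr P) t" for t
    unfolding poly_discr_slice[OF lc] resultant_def sylvester_mat_def
    by (subst det_mat_eq_det_vec[of _ "m + n" e])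
      (use e in \<open>auto simp: sylvester_vec_def degree_slice[OF lc] degree_pderiv m n\<close>)
  have "(?A has_vector_derivative ?N) (at x)"
  proof (rule has_vector_derivative_matrix)
    fix i j
    have c0: "(poly (coeff P k) has_real_derivative coeff D k) (at x)" for k
      by (simp add: coeff_map_poly D_def)
    then have c: "((\<lambda>t. coeff (slice P t) k) has_real_derivative coeff D k) (at x)" for k
      by (simp add: coeff_map_poly)
    have c': "((\<lambda>t. coeff (pderiv (slice P t)) k) has_real_derivative coeff (pderiv D) k) (at x)" for k
      unfolding coeff_pderiv by (rule DERIV_cmult[OF c])
    show "((\<lambda>t. ?A t $ i $ j) has_real_derivative ?N $ i $ j) (at x)"
      by (auto simp: sylvester_vec_def sylvester_mat_sub_index eN c0 c c')
  qed
  moreover obtain L where L: "(Determinants.det has_derivative L) (at (?A x))"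
    using det_has_derivative by blast
  ultimately have "((\<lambda>t. Determinants.det (?A t)) has_derivative (\<lambda>t. L (t *\<^sub>R ?N))) (at x)"
    unfolding has_vector_derivative_def by (rule has_derivative_compose)
  then have "((\<lambda>t. poly (discr P) t) has_derivative (\<lambda>t. L (t *\<^sub>R ?N))) (at x)"
    unfolding det_A .
  moreover have "((\<lambda>t. poly (discr P) t) has_derivative (\<lambda>t. poly (pderiv (discr P)) x * t)) (at x)"
    using poly_DERIV[of "discr P" x] by (simp add: has_field_derivative_def)
  ultimately have "(\<lambda>t. L (t *\<^sub>R ?N)) = (\<lambda>t. poly (pderiv (discr P)) x * t)"
    by (rule has_derivative_unique)
  from fun_cong[OF this, of 1] L show thesis using that by simp
qed

text \<open>The values at 1 and at the variable itself, which are the last two moments, already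
  separate the two functionals.\<close>

lemma moments_independent:
  assumes e: "bij_betw e UNIV {0..<N}" and N: "N \<ge> 2"
    and l: "l1 1 = 1" "l2 1 = 0" "l2 (monom 1 1) \<noteq> 0"
    and 0: "a *\<^sub>R moments e N l1 + b *\<^sub>R moments e N l2 = 0"
  shows "a = 0 \<and> b = 0"
proof -
  have "N - 1 \<in> {0..<N}" "N - 2 \<in> {0..<N}" using N by auto
  then obtain j k where jk: "e j = N - 1" "e k = N - 2"
    using e by (metis bij_betw_iff_bijections)
  have c: "a * moments e N l1 $ i + b * moments e N l2 $ i = 0" for i
    using arg_cong[OF 0, of "\<lambda>v. v $ i"] by simp
  have "a = 0" using c[of j] jk l by (simp add: moments_def monom_0 flip: one_pCons)
  moreover have "N - Suc (N - 2) = 1" using N by simp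
  ultimately show ?thesis using c[of k] jk l by (simp add: moments_def)
qed

text \<open>If two independent functionals vanish on the ideal generated by \<open>P(x, \<sqdot>)\<close> and its
  derivative, the Sylvester matrix has corank at least 2, and its determinant vanishes to
  second order. The type numbered by \<open>e\<close> indexes the rows and columns of that matrix.\<close>

lemma discr_derivative_eq_0_if_two_functionals:
  fixes P :: "real poly poly" and e :: "'n::finite \<Rightarrow> nat"
  assumes lc: "degree (lead_coeff P) = 0" "degree P \<ge> 2"
    and e: "bij_betw e UNIV {0..<2 * degree P - 1}"
    and l: "poly_functional l1" "poly_functional l2" "l1 1 = 1" "l2 1 = 0" "l2 (monom 1 1) \<noteq> 0"
    and van: "\<And>h. l1 (h * slice P x) = 0" "\<And>h. l1 (h * pderiv (slice P x)) = 0"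
      "\<And>h. l2 (h * slice P x) = 0" "\<And>h. l2 (h * pderiv (slice P x)) = 0"
  shows "poly (pderiv (discr P)) x = 0"
proof -
  define m n where mn: "m = degree P" "n = degree P - 1"
  have P0: "P \<noteq> 0" using lc by auto
  have N: "2 * degree P - 1 = m + n" using mn lc by simp
  obtain L where L: "(Determinants.det has_derivative L) (at (sylvester_vec e m n (slice P x) (pderiv (slice P x))))"
    "poly (pderiv (discr P)) x = L (sylvester_vec e m n (map_poly (\<lambda>c. poly (pderiv c) x) P) (pderiv (map_poly (\<lambda>c. poly (pderiv c) x) P)))"
    using discr_derivative[OF lc(1) P0 mn e[unfolded N]] by blast
  have deg: "degree (slice P x) \<le> m" "degree (pderiv (slice P x)) \<le> n"
    by (simp_all add: mn degree_pderiv degree_slice[OF lc(1) P0])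
  show ?thesis
    unfolding L(2)
  proof (rule det_derivative_corank_2[OF L(1), of "moments e (m + n) l1" "moments e (m + n) l2"])
    show "sylvester_vec e m n (slice P x) (pderiv (slice P x)) *v moments e (m + n) l1 = 0"
      "sylvester_vec e m n (slice P x) (pderiv (slice P x)) *v moments e (m + n) l2 = 0"
      by (simp_all add: sylvester_vec_moments[OF e[unfolded N] _ deg] l(1,2) van vec_eq_iff)
    show "a = 0 \<and> b = 0" if "a *\<^sub>R moments e (m + n) l1 + b *\<^sub>R moments e (m + n) l2 = 0" for a b
      using moments_independent[OF e[unfolded N] _ l(3-5) that] lc mn by simp
  qed
qed

text \<open>At a triple root \<open>y\<close> the evaluations of a polynomial and of its derivative at \<open>y\<close> are
  two functionals as above. Otherwise \<open>\<partial>\<^sub>y\<^sup>2 P \<noteq> 0\<close>, the evaluation at \<open>y\<close> gives a kernel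
  vector \<open>w\<close>, and the derivative \<open>N\<close> of the Sylvester matrix maps \<open>w\<close> to \<open>\<partial>\<^sub>x\<partial>\<^sub>y P\<close> times the
  powers \<open>y\<^sup>j\<close> in the rows of the second polynomial, and to 0 in the rows of the first one,
  where \<open>\<partial>\<^sub>x P\<close> is evaluated. The Sylvester matrix itself maps the evaluation of derivatives
  to the same vector, with \<open>\<partial>\<^sub>y\<^sup>2 P\<close> in place of \<open>\<partial>\<^sub>x\<partial>\<^sub>y P\<close>. Hence \<open>N w\<close> lies in its image.\<close>

lemma discr_derivative_eq_0_if_singular_point:
  fixes P :: "real poly poly" and e :: "'n::finite \<Rightarrow> nat"
  assumes lc: "degree (lead_coeff P) = 0" "degree P \<ge> 2"
    and e: "bij_betw e UNIV {0..<2 * degree P - 1}"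
    and root: "poly (slice P x) y = 0" "poly (pderiv (slice P x)) y = 0"
    and px: "poly (pderiv (poly P [:y:])) x = 0"
  shows "poly (pderiv (discr P)) x = 0"
proof -
  define F D where "F = slice P x" and "D = map_poly (\<lambda>c. poly (pderiv c) x) P"
  \<comment> \<open>Differentiation in \<open>x\<close> commutes with the substitution of a constant for \<open>y\<close>.\<close>
  have "poly (pderiv (poly Q [:y:])) x = poly (map_poly (\<lambda>c. poly (pderiv c) x) Q) y" for Q
    by (induction Q) (simp_all add: map_poly_pCons pderiv_add pderiv_smult)
  then have Dy: "poly D y = 0" using px by (simp add: D_def)
  define l l' where "l h = poly h y" and "l' h = poly (pderiv h) y" for h
  have l: "poly_functional l" "poly_functional l'" "l 1 = 1" "l' 1 = 0" "l' (monom 1 1) \<noteq> 0"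
    by (auto simp: poly_functional_def l_def l'_def pderiv_add pderiv_smult pderiv_monom poly_monom)
  show ?thesis
  proof (cases "poly (pderiv (pderiv F)) y = 0")
    case True
    with root show ?thesis
      by (intro discr_derivative_eq_0_if_two_functionals[OF lc e l])
        (simp_all add: l_def l'_def F_def pderiv_mult)
  next
    case False
    define m n where mn: "m = degree P" "n = degree P - 1"
    have P0: "P \<noteq> 0" using lc by auto
    have N: "2 * degree P - 1 = m + n" using mn lc by simp
    obtain L where L: "(Determinants.det has_derivative L) (at (sylvester_vec e m n F (pderiv F)))"
      "poly (pderiv (discr P)) x = L (sylvester_vec e m n D (pderiv D))"
      using discr_derivative[OF lc(1) P0 mn e[unfolded N]] unfolding F_def D_def by blast
    have deg: "degree F \<le> m" "degree (pderiv F) \<le> n" "degree D \<le> m" "degree (pderiv D) \<le> n"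
      using degree_map_poly_le[of "\<lambda>c. poly (pderiv c) x" P]
      by (simp_all add: mn degree_pderiv F_def D_def degree_slice[OF lc(1) P0])
    note mom = sylvester_vec_moments[OF e[unfolded N]]
    let ?c = "poly (pderiv D) y / poly (pderiv (pderiv F)) y"
    show ?thesis
      unfolding L(2)
    proof (rule det_derivative_kernel_image[OF L(1), of "moments e (m + n) l"])
      show "moments e (m + n) l \<noteq> 0"
        using moments_independent[where ?l1.0 = l and ?l2.0 = l' and a = 1 and b = 0, OF e[unfolded N] _ l(3-5)] lc mn by fastforce
      show "sylvester_vec e m n F (pderiv F) *v moments e (m + n) l = 0"
        using root by (simp add: mom[OF l(1) deg(1,2)] l_def F_def[symmetric] vec_eq_iff)
      show "sylvester_vec e m n D (pderiv D) *v moments e (m + n) l =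
          sylvester_vec e m n F (pderiv F) *v (?c *\<^sub>R moments e (m + n) l')"
        using root Dy False
        by (simp add: matrix_vector_mult_scaleR mom[OF l(1) deg(3,4)] mom[OF l(2) deg(1,2)]
            l_def l'_def F_def[symmetric] vec_eq_iff pderiv_mult)
    qed
  qed
qed

text \<open>The real and the imaginary part of the evaluation at \<open>z\<close> are independent functionals
  since \<open>z\<close> is not real. Using them in place of the evaluations at \<open>z\<close> and its conjugate keeps
  all matrices real.\<close>

lemma discr_derivative_eq_0_if_nonreal_double_root:
  fixes P :: "real poly poly" and e :: "'n::finite \<Rightarrow> nat"
  assumes lc: "degree (lead_coeff P) = 0" "degree P \<ge> 2"
    and e: "bij_betw e UNIV {0..<2 * degree P - 1}"
    and root: "poly (map_poly complex_of_real (slice P x)) z = 0"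
      "poly (map_poly complex_of_real (pderiv (slice P x))) z = 0" and z: "Im z \<noteq> 0"
  shows "poly (pderiv (discr P)) x = 0"
proof -
  let ?ev = "\<lambda>h. poly (map_poly complex_of_real h) z"
  interpret C: map_poly_comm_ring_hom complex_of_real ..
  have "map_poly complex_of_real (g * h) = map_poly of_real g * map_poly of_real h" for g h
    by (rule C.hom_mult)
  then have mult: "?ev (g * h) = ?ev g * ?ev h" for g h by simp
  have add: "?ev (g + h) = ?ev g + ?ev h" and smult: "?ev (smult c h) = of_real c * ?ev h" for g h c
    by (simp_all add: hom_distribs)
  define l1 l2 where "l1 h = Re (?ev h)" and "l2 h = Im (?ev h)" for h
  show ?thesis
    by (rule discr_derivative_eq_0_if_two_functionals[OF lc e, of l1 l2])
      (use root z in \<open>simp_all add: l1_def l2_def poly_functional_def mult add smult map_poly_monom poly_monom\<close>)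
qed


section \<open>The characteristic polynomial of the pencil\<close>

lemma coeff_prod_linear:
  fixes f :: "'i \<Rightarrow> 'a::comm_semiring_1 poly"
  assumes "finite S" "\<And>i. i \<in> S \<Longrightarrow> degree (f i) \<le> 1"
  shows "degree (prod f S) \<le> card S \<and> coeff (prod f S) (card S) = (\<Prod>i\<in>S. coeff (f i) 1)"
  using assms
proof (induction rule: finite_induct)
  case (insert i S)
  then have IH: "degree (prod f S) \<le> card S" "coeff (prod f S) (card S) = (\<Prod>i\<in>S. coeff (f i) 1)" by auto
  have fi: "f i = [:coeff (f i) 0, coeff (f i) 1:]"
    using insert.prems[of i] by (intro poly_eqI) (auto simp: coeff_pCons coeff_eq_0 split: nat.splits)
  have "degree (f i * prod f S) \<le> 1 + card S"
    using degree_mult_le[of "f i" "prod f S"] insert.prems[of i] IH(1) by simp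
  moreover have "coeff (f i * prod f S) (Suc (card S)) = coeff (f i) 1 * coeff (prod f S) (card S)"
    using IH(1) by (subst fi) (simp add: coeff_eq_0)
  ultimately show ?case using insert.hyps IH(2) by simp
qed simp

text \<open>In the Leibniz formula every summand is a product of as many polynomials of degree at
  most one as there are rows.\<close>

lemma coeff_det_linear:
  fixes A :: "'a::comm_ring_1 poly^'n^'n"
  assumes "\<And>i j. degree (A $ i $ j) \<le> 1"
  shows "degree (Determinants.det A) \<le> CARD('n)"
    "coeff (Determinants.det A) CARD('n) = Determinants.det (\<chi> i j. coeff (A $ i $ j) 1)"
proof -
  have c: "degree (\<Prod>i\<in>UNIV. A $ i $ p i) \<le> CARD('n)"
    "coeff (\<Prod>i\<in>UNIV. A $ i $ p i) CARD('n) = (\<Prod>i\<in>UNIV. coeff (A $ i $ p i) 1)" for p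
    using coeff_prod_linear[of UNIV "\<lambda>i. A $ i $ p i"] assms by auto
  have s: "(of_int k :: 'a poly) = [:of_int k:]" for k by (simp add: of_int_poly)
  show "degree (Determinants.det A) \<le> CARD('n)"
    unfolding Determinants.det_def s
    by (intro degree_sum_le) (auto intro: order_trans[OF degree_smult_le c(1)])
  show "coeff (Determinants.det A) CARD('n) = Determinants.det (\<chi> i j. coeff (A $ i $ j) 1)"
    unfolding Determinants.det_def s by (simp add: coeff_sum c(2))
qed

lemma det_constant_polys:
  fixes B :: "'a::comm_ring_1^'n^'n"
  shows "Determinants.det (\<chi> i j. [:B $ i $ j:]) = [:Determinants.det B:]"
proof -
  have "(\<Prod>i\<in>S. [:f i:]) = [:\<Prod>i\<in>S. f i:]" for S and f :: "'n \<Rightarrow> 'a"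
    by (induction S rule: infinite_finite_induct) (simp_all flip: one_pCons)
  moreover have "(\<Sum>i\<in>S. [:g i:]) = [:\<Sum>i\<in>S. g i:]" for S and g :: "('n \<Rightarrow> 'n) \<Rightarrow> 'a"
    by (induction S rule: infinite_finite_induct) auto
  ultimately show ?thesis by (simp add: Determinants.det_def of_int_poly mult.commute)
qed

text \<open>The coefficient of \<open>y\<^sup>6\<close> is \<open>det (- K)\<close>, which does not involve \<open>x\<close> and is nonzero
  because \<open>K\<close> is an involution.\<close>

lemma degree_p_poly: "degree (p_poly R) = 6" "degree (lead_coeff (p_poly R)) = 0"
proof -
  define B where "B = matrix (\<lambda>v. - form_op vol_form v)"
  have lin: "linear (\<lambda>v. - form_op vol_form v)"
    by (intro linear_compose_neg linear_form_op)
  have "(\<lambda>v. - form_op vol_form v) \<circ> (\<lambda>v. - form_op vol_form v) = id"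
    by (rule ext) (simp add: linear_neg[OF linear_form_op] star_involution)
  then have "B ** B = mat 1"
    using matrix_compose[OF lin lin] by (simp add: B_def matrix_id_mat_1)
  then have B: "Determinants.det B \<noteq> 0"
    by (metis det_I det_mul mult_zero_left zero_neq_one)
  define A :: "real poly poly^idx2^idx2" where "A = (\<chi> i j.
     [:[:matrix (form_op R) $ i $ j:]:]
     - [:[:0, 1:]:] * (mat 1 :: real poly poly^idx2^idx2) $ i $ j
     - [:0, 1:] * [:[:matrix (form_op vol_form) $ i $ j:]:])"
  have entry: "A $ i $ j = [:[:matrix (form_op R) $ i $ j:] - (if i = j then [:0, 1:] else 0), [:B $ i $ j:]:]" for i j
    by (simp add: A_def B_def mat_def matrix_def)
  have "p_poly R = Determinants.det A" by (simp add: p_poly_def A_def)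
  moreover have "(\<chi> i j. coeff (A $ i $ j) 1) = (\<chi> i j. [:B $ i $ j:])" by (simp add: entry)
  ultimately have "degree (p_poly R) \<le> 6" "coeff (p_poly R) 6 = [:Determinants.det B:]"
    using coeff_det_linear[of A] by (auto simp: card_idx2 det_constant_polys entry)
  moreover from this B show "degree (p_poly R) = 6" by (intro antisym le_degree) auto
  ultimately show "degree (lead_coeff (p_poly R)) = 0" by simp
qed

definition pencil :: "(4 \<Rightarrow> 4 \<Rightarrow> 4 \<Rightarrow> 4 \<Rightarrow> real) \<Rightarrow> real \<Rightarrow> real \<Rightarrow> real^idx2^idx2" where
  "pencil R x y = matrix (form_op R) - x *\<^sub>R mat 1 - y *\<^sub>R matrix (form_op vol_form)"

lemma pencil_mult: "pencil R x y *v v = form_op R v - x *\<^sub>R v - y *\<^sub>R form_op vol_form v"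
  by (simp add: pencil_def matrix_vector_mult_diff_rdistrib scaleR_matrix_vector_assoc[symmetric]
      matrix_works linear_form_op)

lemma pencil_symmetric:
  assumes sym: "\<And>u v. u \<bullet> form_op R v = form_op R u \<bullet> v"
  shows "v v* pencil R x y = pencil R x y *v v"
proof (rule vector_eq_ldot[THEN iffD1], rule allI)
  fix w
  have "(v v* pencil R x y) \<bullet> w = v \<bullet> (pencil R x y *v w)" by (rule dot_lmul_matrix)
  also have "\<dots> = (pencil R x y *v v) \<bullet> w"
    by (simp add: pencil_mult inner_diff_right inner_diff_left sym star_selfadjoint)
  finally show "w \<bullet> (v v* pencil R x y) = w \<bullet> (pencil R x y *v v)" by (simp add: inner_commute)
qed

lemma p_poly_derivatives:
  assumes L: "(Determinants.det has_derivative L) (at (pencil R x y))"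
  shows "poly (pderiv (slice (p_poly R) x)) y = L (- matrix (form_op vol_form))"
    "poly (pderiv (poly (p_poly R) [:y:])) x = L (- mat 1)"
proof -
  have along: "poly (pderiv g) t = L N"
    if g: "\<And>s. poly g s = Determinants.det (A s)" and A: "(A has_vector_derivative N) (at t)" "A t = pencil R x y"
    for g A N t
  proof -
    have "((\<lambda>s. Determinants.det (A s)) has_derivative (\<lambda>s. L (s *\<^sub>R N))) (at t)"
      using has_derivative_compose[OF A(1)[unfolded has_vector_derivative_def], of Determinants.det L]
        L A(2) by simp
    moreover have "((\<lambda>s. Determinants.det (A s)) has_derivative (\<lambda>s. poly (pderiv g) t * s)) (at t)"
      using poly_DERIV[of g t] unfolding g by (simp add: has_field_derivative_def)
    ultimately have "(\<lambda>s. L (s *\<^sub>R N)) = (\<lambda>s. poly (pderiv g) t * s)" by (rule has_derivative_unique)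
    from fun_cong[OF this, of 1] show ?thesis by simp
  qed
  show "poly (pderiv (slice (p_poly R) x)) y = L (- matrix (form_op vol_form))"
    by (rule along[of _ "\<lambda>y. pencil R x y"])
      (auto simp: poly_slice poly_p_poly pencil_def intro!: derivative_eq_intros)
  show "poly (pderiv (poly (p_poly R) [:y:])) x = L (- mat 1)"
    by (rule along[of _ "\<lambda>x. pencil R x y"])
      (auto simp: poly_p_poly pencil_def intro!: derivative_eq_intros)
qed

text \<open>The pencil is symmetric, so \<open>v\<close> is also a left kernel vector, and the constant \<open>c\<close>
  depends only on the pencil at \<open>(x, y)\<close> and on \<open>v\<close>. It is the same for both partial
  derivatives; this is what links a multiple root in \<open>y\<close> to the nullity of \<open>v\<close>.\<close>

lemma p_poly_derivatives_at_kernel: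
  assumes sym: "\<And>u v. u \<bullet> form_op R v = form_op R u \<bullet> v"
    and v: "v \<noteq> 0" "pencil R x y *v v = 0"
  obtains c where "poly (pderiv (slice (p_poly R) x)) y = c * (v \<bullet> form_op vol_form v)"
    "poly (pderiv (poly (p_poly R) [:y:])) x = c * (v \<bullet> v)"
proof -
  obtain L where L: "(Determinants.det has_derivative L) (at (pencil R x y))"
    using det_has_derivative by blast
  obtain c where c: "\<And>N. L N = c * (v \<bullet> (N *v v))"
    using det_derivative_singular[OF L v v(1)] v(2) pencil_symmetric[OF sym] by metis
  have neg: "(- A) *v v = - (A *v v)" for A :: "real^idx2^idx2"
    by (simp add: matrix_vector_mult_def vec_eq_iff sum_negf)
  show thesis
    by (rule that[of "- c"])
      (simp_all add: p_poly_derivatives[OF L] c neg matrix_works linear_form_op)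
qed

lemma slice_p_poly_eq_0_iff: "poly (slice (p_poly R) x) y = 0 \<longleftrightarrow> (\<exists>v. v \<noteq> 0 \<and> pencil R x y *v v = 0)"
proof -
  have "poly (slice (p_poly R) x) y = Determinants.det (pencil R x y)"
    by (simp add: poly_slice poly_p_poly pencil_def)
  then show ?thesis
    by (metis invertible_det_nz invertible_left_inverse matrix_left_invertible_ker)
qed

lemma poly_q_poly: "poly (q_poly R) x = discr (slice (p_poly R) x)" "slice (p_poly R) x \<noteq> 0"
proof -
  have P: "p_poly R \<noteq> 0" using degree_p_poly[of R] by auto
  have "degree (slice (p_poly R) x) = 6" using degree_slice degree_p_poly P by metis
  then show ne: "slice (p_poly R) x \<noteq> 0" by auto
  show "poly (q_poly R) x = discr (slice (p_poly R) x)"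
    using poly_discr_slice[OF degree_p_poly(2) P, of x] ne
    by (simp add: q_poly_def discr_def[of "slice (p_poly R) x"])
qed

section \<open>Critical values as roots of the discriminant\<close>

lemma critical_value_imp_q_root:
  assumes sym: "\<And>u v. u \<bullet> form_op R v = form_op R u \<bullet> v"
    and v: "v \<in> S2" "form_op R v = x *\<^sub>R v + y *\<^sub>R form_op vol_form v"
  shows "poly (q_poly R) x = 0"
proof -
  have v0: "v \<noteq> 0" and ker: "pencil R x y *v v = 0" and null: "v \<bullet> form_op vol_form v = 0"
    using v by (auto simp: pencil_mult S2_iff)
  have "poly (slice (p_poly R) x) y = 0" using v0 ker slice_p_poly_eq_0_iff by blast
  moreover have "poly (pderiv (slice (p_poly R) x)) y = 0"
    using p_poly_derivatives_at_kernel[OF sym v0 ker] null by (metis mult_zero_right)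
  ultimately show ?thesis
    by (simp add: poly_q_poly discr_eq_0_if_double_root)
qed

text \<open>Simplicity of the root \<open>x\<close> of \<open>q\<close> ensures that the multiple root of \<open>p(x, \<sqdot>)\<close> is real
  and that \<open>\<partial>\<^sub>x p \<noteq> 0\<close> there; the constant of \<open>p_poly_derivatives_at_kernel\<close> is then nonzero.\<close>

lemma simple_q_root_imp_critical_value:
  assumes sym: "\<And>u v. u \<bullet> form_op R v = form_op R u \<bullet> v"
    and q: "poly (q_poly R) x = 0" "discr (q_poly R) \<noteq> 0"
  obtains v y where "v \<in> S2" "form_op R v = x *\<^sub>R v + y *\<^sub>R form_op vol_form v"
proof -
  let ?F = "slice (p_poly R) x"
  have simple: "poly (pderiv (q_poly R)) x \<noteq> 0"
    using q discr_eq_0_if_double_root by blast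
  \<comment> \<open>The Sylvester matrix of polynomials of degrees 6 and 5 has 11 rows.\<close>
  obtain e :: "11 \<Rightarrow> nat" where e: "bij_betw e UNIV {0..<11}"
    using finite_same_card_bij[of "UNIV :: 11 set" "{0..<11::nat}"] by auto
  have P: "degree (lead_coeff (p_poly R)) = 0" "degree (p_poly R) \<ge> 2"
      "bij_betw e UNIV {0..<2 * degree (p_poly R) - 1}"
    using degree_p_poly[of R] e by auto
  obtain z where z: "poly (map_poly complex_of_real ?F) z = 0"
      "poly (map_poly complex_of_real (pderiv ?F)) z = 0"
    using complex_double_root_if_discr_eq_0[of ?F] q(1) poly_q_poly by metis
  have "Im z = 0"
    using discr_derivative_eq_0_if_nonreal_double_root[OF P z] simple by (auto simp: q_poly_def)
  then obtain y where y: "z = complex_of_real y" by (metis complex_is_Real_iff Reals_cases)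
  with z have F: "poly ?F y = 0" "poly (pderiv ?F) y = 0" by simp_all
  then obtain v where v: "v \<noteq> 0" "pencil R x y *v v = 0" using slice_p_poly_eq_0_iff by blast
  obtain c where c: "poly (pderiv ?F) y = c * (v \<bullet> form_op vol_form v)"
    "poly (pderiv (poly (p_poly R) [:y:])) x = c * (v \<bullet> v)"
    using p_poly_derivatives_at_kernel[OF sym v] .
  have "poly (pderiv (poly (p_poly R) [:y:])) x \<noteq> 0"
    using discr_derivative_eq_0_if_singular_point[OF P F] simple by (auto simp: q_poly_def)
  then have null: "v \<bullet> form_op vol_form v = 0" using c F(2) by auto
  let ?u = "(1 / norm v) *\<^sub>R v"
  have s: "form_op T ?u = (1 / norm v) *\<^sub>R form_op T v" for T
    by (rule linear_scale[OF linear_form_op])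
  have "form_op R v = x *\<^sub>R v + y *\<^sub>R form_op vol_form v"
    using v(2) by (simp add: pencil_mult algebra_simps)
  then have "form_op R ?u = x *\<^sub>R ?u + y *\<^sub>R form_op vol_form ?u"
    by (simp add: s scaleR_add_right mult.commute)
  moreover have "?u \<in> S2"
    using v(1) null by (simp add: S2_iff s power2_norm_eq_inner[symmetric] power2_eq_square)
  ultimately show thesis using that by blast
qed

theorem theorem1p1:
  fixes R :: "4 \<Rightarrow> 4 \<Rightarrow> 4 \<Rightarrow> 4 \<Rightarrow> real"
  assumes "riemann_tensor R"
  shows
    "critical_values_on S2 (sec_curv R) \<subseteq> {x. poly (q_poly R) x = 0} \<and>
     (discr (q_poly R) \<noteq> 0 \<longrightarrow>
        critical_values_on S2 (sec_curv R) = {x. poly (q_poly R) x = 0}) \<and>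
     ((\<forall>x. poly (q_poly R) x = 0 \<longrightarrow> x > 0) \<longrightarrow> sectionally_positive R) \<and>
     ((\<forall>x. poly (q_poly R) x = 0 \<longrightarrow> x \<ge> 0) \<longrightarrow> sectionally_nonnegative R) \<and>
     (discr (q_poly R) \<noteq> 0 \<longrightarrow>
        (sectionally_positive R \<longleftrightarrow> (\<forall>x. poly (q_poly R) x = 0 \<longrightarrow> x > 0)) \<and>
        (sectionally_nonnegative R \<longleftrightarrow> (\<forall>x. poly (q_poly R) x = 0 \<longrightarrow> x \<ge> 0)))"
proof -
  have sym: "u \<bullet> form_op R v = form_op R u \<bullet> v" for u v
    using assms unfolding riemann_tensor_def by (intro form_op_selfadjoint) blast+
  have crit: "x \<in> critical_values_on S2 (sec_curv R) \<longleftrightarrow>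
      (\<exists>v y. v \<in> S2 \<and> form_op R v = x *\<^sub>R v + y *\<^sub>R form_op vol_form v)" for x
    unfolding critical_values_on_def by (auto simp: critical_point_iff[OF sym] image_iff) (metis sec_curv_multiplier)+
  have sub: "critical_values_on S2 (sec_curv R) \<subseteq> {x. poly (q_poly R) x = 0}"
    using crit critical_value_imp_q_root[OF sym] by auto
  have eq: "critical_values_on S2 (sec_curv R) = {x. poly (q_poly R) x = 0}"
    if simple: "discr (q_poly R) \<noteq> 0"
  proof (intro subset_antisym sub subsetI)
    fix x assume "x \<in> {x. poly (q_poly R) x = 0}"
    then obtain v y where "v \<in> S2" "form_op R v = x *\<^sub>R v + y *\<^sub>R form_op vol_form v"
      using simple_q_root_imp_critical_value[OF sym _ simple] by blast
    then show "x \<in> critical_values_on S2 (sec_curv R)" using crit by blast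
  qed
  obtain v0 where v0: "critical_point_on S2 (sec_curv R) v0" "\<forall>w\<in>S2. sec_curv R v0 \<le> sec_curv R w"
    using critical_minimum[OF sym] by blast
  define m where "m = sec_curv R v0"
  have m: "m \<in> critical_values_on S2 (sec_curv R)" "\<And>v. v \<in> S2 \<Longrightarrow> m \<le> sec_curv R v"
    using v0 by (auto simp: m_def critical_values_on_def)
  have attained: "\<exists>v\<in>S2. x = sec_curv R v" if "x \<in> critical_values_on S2 (sec_curv R)" for x
    using that by (auto simp: critical_values_on_def critical_point_on_def)
  have root: "poly (q_poly R) m = 0" using m(1) sub by blast
  show ?thesis
    unfolding sectionally_positive_def sectionally_nonnegative_def
  proof (intro conjI impI)
    assume "\<forall>x. poly (q_poly R) x = 0 \<longrightarrow> x > 0"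
    then show "\<forall>v\<in>S2. sec_curv R v > 0" using root m(2) by force
  next
    assume "\<forall>x. poly (q_poly R) x = 0 \<longrightarrow> x \<ge> 0"
    then show "\<forall>v\<in>S2. sec_curv R v \<ge> 0" using root m(2) by force
  next
    assume "discr (q_poly R) \<noteq> 0"
    from eq[OF this] attained have "\<exists>v\<in>S2. x = sec_curv R v" if "poly (q_poly R) x = 0" for x
      using that by blast
    then show "(\<forall>v\<in>S2. sec_curv R v > 0) \<longleftrightarrow> (\<forall>x. poly (q_poly R) x = 0 \<longrightarrow> x > 0)"
      "(\<forall>v\<in>S2. sec_curv R v \<ge> 0) \<longleftrightarrow> (\<forall>x. poly (q_poly R) x = 0 \<longrightarrow> x \<ge> 0)"
      using root m(2) by force+
  qed (use sub eq in auto)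
qed

end
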